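(* Let $(\mathcal{A},\rho,\pi)$ be a compact quantum metric space, where $\pi$ is the direct sum of the family $\{\pi_i:\mathcal{A}\to\mathbf{L}(\mathcal{H}_i)\}$ of pairwise inequivalent irreducible representations. Suppose $i\neq j$, and let $v\in\mathcal{H}_i$ and $w\in\mathcal{H}_j$ be unit vectors. Let $\phi$ and $\psi$ be the pure states on $\mathcal{A}$ defined by $\phi(a)=\langle\pi_i(a)v,v\rangle$ and $\psi(a)=\langle\pi_j(a)w,w\rangle$. Then $$d(\phi,\psi)\leq\|\rho(v\otimes w)\|,$$ where $d$ is the semimetric on the state space of $\mathcal{A}$ induced by the Lipschitz seminorm of $\rho$ via the Monge–Kantorovich formula.
   Context: Notation: $\check{\otimes}$ denotes the spatial (minimal) tensor product of C*-algebras; $\bar{\otimes}$ denotes the Hilbert space tensor product (for Hilbert spaces) and the von Neumann algebra tensor product (for von Neumann algebras); $\mathbf{L}(\mathcal{H})$ is the algebra of bounded operators on the Hilbert space $\mathcal{H}$. Atomic representation: a representation $\pi$ of a unital C*-algebra $\mathcal{A}$ on a Hilbert space $\mathcal{H}$ is called atomic if there is a family $\{\pi_i:\mathcal{A}\to\mathbf{L}(\mathcal{H}_i)\}$ of pairwise inequivalent irreducible representations of $\mathcal{A}$ with $\pi=\bigoplus_i\pi_i$ (so $\mathcal{H}=\bigoplus_i\mathcal{H}_i$ and $\pi(\mathcal{A})''=\bigoplus_i\mathbf{L}(\mathcal{H}_i)$). Let $\pi:\mathcal{A}\to\mathbf{L}(\mathcal{H})$ be a faithful atomic representation; regard $\mathcal{A}\subseteq\mathbf{L}(\mathcal{H})$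 via $\pi$, write $\mathcal{A}''=\pi(\mathcal{A})''$, and regard $\mathcal{A}\check{\otimes}\mathcal{A}\subseteq\mathcal{A}''\bar{\otimes}\mathcal{A}''\subseteq\mathbf{L}(\mathcal{H}\bar{\otimes}\mathcal{H})$. Let $P_\delta\in\mathcal{A}''\bar{\otimes}\mathcal{A}''$ be the supremum of all projections of the form $p\otimes p$ with $p\in\mathcal{A}''$ a minimal projection, and let $\mathcal{H}_\delta\subseteq\mathcal{H}\bar{\otimes}\mathcal{H}$ be the image of $P_\delta$. Compact quantum metric space: a triple $(\mathcal{A},\rho,\pi)$ where $\mathcal{A}$ is a unital C*-algebra, $\pi:\mathcal{A}\to\mathbf{L}(\mathcal{H})$ is a faithful atomic representation, and $\rho\in\mathcal{A}\check{\otimes}\mathcal{A}$ satisfies: (i)$'$ $\rho$ is a positive element of $\mathcal{A}\check{\otimes}\mathcal{A}$; (ii)$'$ $\rho P_\delta=P_\delta\rho=0$; (iii)$'$ $0$ is not an eigenvalue of the operator $\rho|_{\mathcal{H}_\delta^\perp}\in\mathbf{L}(\mathcal{H}_\delta^\perp)$; (iv)$'$ $\mathfrak{F}(\rho)=\rho$, where $\mathfrak{F}:\mathcal{A}\check{\otimes}\mathcal{A}\to\mathcal{A}\check{\otimes}\mathcal{A}$ is the flip $a\otimes b\mapsto b\otimes a$; (v)$'$ $\mathfrak{M}(\rho)\leq\rho\otimes1+1\otimes\rho$ in $\mathcal{A}\check{\otimes}\mathcal{A}\check{\otimes}\mathcal{A}$, where $\mathfrak{M}:\mathcal{A}\check{\otimes}\mathcal{A}\to\mathcal{A}\check{\otimes}\mathcal{A}\check{\otimes}\mathcal{A}$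 is the *-morphism with $\mathfrak{M}(a\otimes b)=a\otimes1\otimes b$. Lipschitz seminorm: let $\rho^{-1}$ denote the inverse of the (injective) operator $\rho|_{\mathcal{H}_\delta^\perp}$, defined on the image of $\rho|_{\mathcal{H}_\delta^\perp}$. For $a\in\mathcal{A}$, $\|a\|_{Lip}\in[0,\infty]$ is the operator norm of $(a\otimes1-1\otimes a)\rho^{-1}$ as an operator from the image of $\rho|_{\mathcal{H}_\delta^\perp}$ into $\mathcal{H}\bar{\otimes}\mathcal{H}$. Semimetric: for states $\phi,\psi$ of $\mathcal{A}$, $d(\phi,\psi):=\sup\{|\phi(a)-\psi(a)| : a\in\mathcal{A},\ a^*=a,\ \|a\|_{Lip}\leq1\}$. *)

theory Defs
  imports "HOL-Analysis.Analysis" "HOL-Library.Complex_Order"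
begin

section \<open>Complex normed spaces, Hilbert spaces and unital C*-algebras\<close>

class scaleC =
  fixes scaleC :: "complex \<Rightarrow> 'a \<Rightarrow> 'a" (infixr \<open>*\<^sub>C\<close> 75)

class complex_normed_vector = real_normed_vector + scaleC +
  assumes scaleC_add_right: "c *\<^sub>C (x + y) = c *\<^sub>C x + c *\<^sub>C y"
    and scaleC_add_left: "(c + d) *\<^sub>C x = c *\<^sub>C x + d *\<^sub>C x"
    and scaleC_scaleC: "c *\<^sub>C d *\<^sub>C x = (c * d) *\<^sub>C x"
    and scaleC_of_real: "complex_of_real r *\<^sub>C x = r *\<^sub>R x"
    and norm_scaleC: "norm (c *\<^sub>C x) = cmod c * norm x"

global_interpretation complex_vector:
  vector_space "scaleC :: complex \<Rightarrow> 'a \<Rightarrow> 'a::complex_normed_vector"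
  defines csubspace = complex_vector.subspace
    and cspan = complex_vector.span
  using scaleC_of_real [of 1]
  by unfold_locales (simp_all add: scaleC_add_right scaleC_add_left scaleC_scaleC)

text \<open>The inner product is linear in the first argument, so that
  \<open>a \<mapsto> \<langle>\<pi>(a) v, v\<rangle>\<close> is a linear functional.\<close>

class complex_hilbert_space = complex_normed_vector + complete_space +
  fixes cinner :: "'a \<Rightarrow> 'a \<Rightarrow> complex"
  assumes cinner_add_left: "cinner (x + y) z = cinner x z + cinner y z"
    and cinner_scaleC_left: "cinner (c *\<^sub>C x) y = c * cinner x y"
    and cinner_commute: "cinner x y = cnj (cinner y x)"
    and cinner_self: "cinner x x = complex_of_real ((norm x)\<^sup>2)"

class unital_cstar_algebra = complex_normed_vector + real_normed_algebra_1 + complete_space +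
  fixes star :: "'a \<Rightarrow> 'a"
  assumes mult_scaleC_left: "(c *\<^sub>C x) * y = c *\<^sub>C (x * y)"
    and mult_scaleC_right: "x * (c *\<^sub>C y) = c *\<^sub>C (x * y)"
    and star_star: "star (star x) = x"
    and star_add: "star (x + y) = star x + star y"
    and star_scaleC: "star (c *\<^sub>C x) = cnj c *\<^sub>C star x"
    and star_mult: "star (x * y) = star y * star x"
    and cstar_identity: "norm (star x * x) = (norm x)\<^sup>2"

instantiation blinfun :: (real_normed_vector, complex_normed_vector) complex_normed_vector
begin

lift_definition scaleC_blinfun :: "complex \<Rightarrow> 'a \<Rightarrow>\<^sub>L 'b \<Rightarrow> 'a \<Rightarrow>\<^sub>L 'b"
  is "\<lambda>c f x. c *\<^sub>C f x"
proof -
  fix c :: complex and f :: "'a \<Rightarrow> 'b"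
  assume f: "bounded_linear f"
  have "bounded_linear (\<lambda>y::'b. c *\<^sub>C y)"
    by (rule bounded_linear_intro[where K = "cmod c"])
      (simp_all add: scaleC_add_right scaleC_scaleC norm_scaleC mult.commute
        flip: scaleC_of_real)
  then show "bounded_linear (\<lambda>x. c *\<^sub>C f x)"
    using f by (rule bounded_linear_compose)
qed

instance
proof
  fix c d :: complex and r :: real and x y :: "'a \<Rightarrow>\<^sub>L 'b"
  show "c *\<^sub>C (x + y) = c *\<^sub>C x + c *\<^sub>C y"
    by transfer (simp add: scaleC_add_right)
  show "(c + d) *\<^sub>C x = c *\<^sub>C x + d *\<^sub>C x"
    by transfer (simp add: scaleC_add_left)
  show "c *\<^sub>C d *\<^sub>C x = (c * d) *\<^sub>C x"
    by transfer (simp add: scaleC_scaleC)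
  show "complex_of_real r *\<^sub>C x = r *\<^sub>R x"
    by transfer (simp add: scaleC_of_real)
  have le: "norm (c *\<^sub>C x) \<le> cmod c * norm x" for c and x :: "'a \<Rightarrow>\<^sub>L 'b"
  proof (rule norm_blinfun_bound)
    show "norm (blinfun_apply (c *\<^sub>C x) u) \<le> cmod c * norm x * norm u" for u
      using norm_blinfun[of x u]
      by (simp add: scaleC_blinfun.rep_eq norm_scaleC mult.assoc mult_left_mono)
  qed simp
  have zero: "0 *\<^sub>C x = 0"
    using scaleC_of_real[of 0] by (intro blinfun_eqI) (simp add: scaleC_blinfun.rep_eq)
  show "norm (c *\<^sub>C x) = cmod c * norm x"
  proof (cases "c = 0")
    case True
    then show ?thesis by (simp add: zero)
  next
    case False
    have "inverse c *\<^sub>C c *\<^sub>C x = x"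
      using False by (intro blinfun_eqI) (simp add: scaleC_blinfun.rep_eq scaleC_scaleC)
    then have "norm x \<le> cmod (inverse c) * norm (c *\<^sub>C x)"
      using le[of "inverse c" "c *\<^sub>C x"] by simp
    then have "cmod c * norm x \<le> norm (c *\<^sub>C x)"
      using False by (simp add: norm_inverse norm_divide field_simps)
    with le show ?thesis by (simp add: antisym)
  qed
qed

end


section \<open>Bounded operators\<close>

text \<open>Elements of \<open>'h \<Rightarrow>\<^sub>L 'k\<close> are only real-linear; \<open>L(H)\<close> is the set of complex-linear ones.\<close>

definition clinear_op :: "('h::complex_normed_vector \<Rightarrow>\<^sub>L 'k::complex_normed_vector) \<Rightarrow> bool" where
  "clinear_op T \<longleftrightarrow> (\<forall>c x. T (c *\<^sub>C x) = c *\<^sub>C T x)"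

definition bounded_ops :: "('h::complex_hilbert_space \<Rightarrow>\<^sub>L 'h) set" where
  "bounded_ops = {T. clinear_op T}"

definition is_adjoint :: "('h::complex_hilbert_space \<Rightarrow>\<^sub>L 'h) \<Rightarrow> ('h \<Rightarrow>\<^sub>L 'h) \<Rightarrow> bool" where
  "is_adjoint T S \<longleftrightarrow> (\<forall>x y. cinner (T x) y = cinner x (S y))"

text \<open>In the order of \<open>Complex_Order\<close>, \<open>0 \<le> z\<close> says that \<open>z\<close> is real and nonnegative.\<close>

definition positive_op :: "('h::complex_hilbert_space \<Rightarrow>\<^sub>L 'h) \<Rightarrow> bool" where
  "positive_op T \<longleftrightarrow> T \<in> bounded_ops \<and> (\<forall>x. 0 \<le> cinner (T x) x)"

definition op_le :: "('h::complex_hilbert_space \<Rightarrow>\<^sub>L 'h) \<Rightarrow> ('h \<Rightarrow>\<^sub>L 'h) \<Rightarrow> bool" where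
  "op_le S T \<longleftrightarrow> positive_op (T - S)"

definition commutant :: "('h::complex_hilbert_space \<Rightarrow>\<^sub>L 'h) set \<Rightarrow> ('h \<Rightarrow>\<^sub>L 'h) set" where
  "commutant M = {T \<in> bounded_ops. \<forall>S\<in>M. T o\<^sub>L S = S o\<^sub>L T}"

definition projections_in :: "('h::complex_hilbert_space \<Rightarrow>\<^sub>L 'h) set \<Rightarrow> ('h \<Rightarrow>\<^sub>L 'h) set" where
  "projections_in M = {p \<in> M. p \<in> bounded_ops \<and> p o\<^sub>L p = p \<and> is_adjoint p p}"

definition minimal_projections :: "('h::complex_hilbert_space \<Rightarrow>\<^sub>L 'h) set \<Rightarrow> ('h \<Rightarrow>\<^sub>L 'h) set" where
  "minimal_projections M =
    {p \<in> projections_in M. p \<noteq> 0 \<and> (\<forall>q\<in>projections_in M. op_le q p \<longrightarrow> q = 0 \<or> q = p)}"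

definition orth_compl :: "'h::complex_hilbert_space set \<Rightarrow> 'h set" where
  "orth_compl X = {x. \<forall>y\<in>X. cinner x y = 0}"

definition star_morphism ::
  "('h::complex_hilbert_space \<Rightarrow>\<^sub>L 'h) set \<Rightarrow> ('k::complex_hilbert_space \<Rightarrow>\<^sub>L 'k) set \<Rightarrow>
    (('h \<Rightarrow>\<^sub>L 'h) \<Rightarrow> ('k \<Rightarrow>\<^sub>L 'k)) \<Rightarrow> bool" where
  "star_morphism M N F \<longleftrightarrow>
    (\<forall>S\<in>M. F S \<in> N) \<and>
    (\<forall>S\<in>M. \<forall>T\<in>M. F (S + T) = F S + F T) \<and>
    (\<forall>c. \<forall>S\<in>M. F (c *\<^sub>C S) = c *\<^sub>C F S) \<and>
    (\<forall>S\<in>M. \<forall>T\<in>M. F (S o\<^sub>L T) = F S o\<^sub>L F T) \<and>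
    (\<forall>S\<in>M. \<forall>T\<in>M. is_adjoint S T \<longrightarrow> is_adjoint (F S) (F T))"


section \<open>Representations\<close>

text \<open>A representation is given on a closed subspace \<open>K\<close> of an ambient Hilbert space, so that
  families of representations on different Hilbert spaces can be formed. Only the values of \<open>r a\<close>
  on \<open>K\<close> matter.\<close>

definition representation_on ::
  "'h::complex_hilbert_space set \<Rightarrow> ('a::unital_cstar_algebra \<Rightarrow> 'h \<Rightarrow> 'h) \<Rightarrow> bool" where
  "representation_on K r \<longleftrightarrow>
    csubspace K \<and> closed K \<and>
    (\<forall>a. \<forall>x\<in>K. r a x \<in> K) \<and>
    (\<forall>a. \<forall>x\<in>K. \<forall>y\<in>K. r a (x + y) = r a x + r a y) \<and>
    (\<forall>a c. \<forall>x\<in>K. r a (c *\<^sub>C x) = c *\<^sub>C r a x) \<and>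
    (\<forall>a. \<exists>B. \<forall>x\<in>K. norm (r a x) \<le> B * norm x) \<and>
    (\<forall>a b. \<forall>x\<in>K. r (a + b) x = r a x + r b x) \<and>
    (\<forall>c a. \<forall>x\<in>K. r (c *\<^sub>C a) x = c *\<^sub>C r a x) \<and>
    (\<forall>a b. \<forall>x\<in>K. r (a * b) x = r a (r b x)) \<and>
    (\<forall>x\<in>K. r 1 x = x) \<and>
    (\<forall>a. \<forall>x\<in>K. \<forall>y\<in>K. cinner (r a x) y = cinner x (r (star a) y))"

definition irreducible_on ::
  "'h::complex_hilbert_space set \<Rightarrow> ('a::unital_cstar_algebra \<Rightarrow> 'h \<Rightarrow> 'h) \<Rightarrow> bool" where
  "irreducible_on K r \<longleftrightarrow> representation_on K r \<and> K \<noteq> {0} \<and>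
    (\<forall>M. csubspace M \<and> closed M \<and> M \<subseteq> K \<and> (\<forall>a. \<forall>x\<in>M. r a x \<in> M) \<longrightarrow> M = {0} \<or> M = K)"

definition unitarily_equivalent ::
  "'h::complex_hilbert_space set \<Rightarrow> ('a::unital_cstar_algebra \<Rightarrow> 'h \<Rightarrow> 'h) \<Rightarrow>
    'h set \<Rightarrow> ('a \<Rightarrow> 'h \<Rightarrow> 'h) \<Rightarrow> bool" where
  "unitarily_equivalent K r K' r' \<longleftrightarrow> (\<exists>U :: 'h \<Rightarrow> 'h.
    (\<forall>x\<in>K. \<forall>y\<in>K. U (x + y) = U x + U y) \<and>
    (\<forall>c. \<forall>x\<in>K. U (c *\<^sub>C x) = c *\<^sub>C U x) \<and>
    (\<forall>x\<in>K. norm (U x) = norm x) \<and> U ` K = K' \<and>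
    (\<forall>a. \<forall>x\<in>K. U (r a x) = r' a (U x)))"

text \<open>Direct sums are internal: the spaces \<open>K i\<close> are mutually orthogonal closed subspaces whose
  closed linear span is the whole space.\<close>

definition direct_sum_rep ::
  "'i set \<Rightarrow> ('i \<Rightarrow> 'h::complex_hilbert_space set) \<Rightarrow>
    ('i \<Rightarrow> 'a::unital_cstar_algebra \<Rightarrow> 'h \<Rightarrow> 'h) \<Rightarrow> ('a \<Rightarrow> 'h \<Rightarrow>\<^sub>L 'h) \<Rightarrow> bool" where
  "direct_sum_rep I K r \<pi> \<longleftrightarrow>
    (\<forall>i\<in>I. representation_on (K i) (r i)) \<and>
    (\<forall>i\<in>I. \<forall>j\<in>I. i \<noteq> j \<longrightarrow> (\<forall>x\<in>K i. \<forall>y\<in>K j. cinner x y = 0)) \<and>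
    closure (cspan (\<Union>i\<in>I. K i)) = UNIV \<and>
    (\<forall>a. \<forall>i\<in>I. \<forall>x\<in>K i. \<pi> a x = r i a x)"

definition atomic_decomposition ::
  "'i set \<Rightarrow> ('i \<Rightarrow> 'h::complex_hilbert_space set) \<Rightarrow>
    ('i \<Rightarrow> 'a::unital_cstar_algebra \<Rightarrow> 'h \<Rightarrow> 'h) \<Rightarrow> ('a \<Rightarrow> 'h \<Rightarrow>\<^sub>L 'h) \<Rightarrow> bool" where
  "atomic_decomposition I K r \<pi> \<longleftrightarrow>
    (\<forall>i\<in>I. irreducible_on (K i) (r i)) \<and>
    (\<forall>i\<in>I. \<forall>j\<in>I. i \<noteq> j \<longrightarrow> \<not> unitarily_equivalent (K i) (r i) (K j) (r j)) \<and>
    direct_sum_rep I K r \<pi>"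

text \<open>Every family as above can be reindexed by the (distinct) subspaces themselves, so the
  choice of the index type below is no restriction.\<close>

definition faithful_atomic ::
  "('a::unital_cstar_algebra \<Rightarrow> 'h::complex_hilbert_space \<Rightarrow>\<^sub>L 'h) \<Rightarrow> bool" where
  "faithful_atomic \<pi> \<longleftrightarrow>
    representation_on UNIV (\<lambda>a. blinfun_apply (\<pi> a)) \<and> inj \<pi> \<and>
    (\<exists>(I :: 'h set set) K r. atomic_decomposition I K r \<pi>)"


section \<open>Tensor products\<close>

text \<open>\<open>hilbert_tensor t\<close> says that \<open>'t\<close>, with \<open>t v w\<close> in the role of \<open>v \<otimes> w\<close>, is the Hilbert space
  tensor product of \<open>'h\<close> and \<open>'k\<close>; this determines \<open>('t, t)\<close> up to a unique unitary.\<close>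

definition hilbert_tensor ::
  "('h::complex_hilbert_space \<Rightarrow> 'k::complex_hilbert_space \<Rightarrow> 't::complex_hilbert_space) \<Rightarrow> bool" where
  "hilbert_tensor t \<longleftrightarrow>
    (\<forall>v v' w. t (v + v') w = t v w + t v' w) \<and>
    (\<forall>v w w'. t v (w + w') = t v w + t v w') \<and>
    (\<forall>c v w. t (c *\<^sub>C v) w = c *\<^sub>C t v w) \<and>
    (\<forall>c v w. t v (c *\<^sub>C w) = c *\<^sub>C t v w) \<and>
    (\<forall>v w v' w'. cinner (t v w) (t v' w') = cinner v v' * cinner w w') \<and>
    closure (cspan (range (\<lambda>(v, w). t v w))) = UNIV"

definition op_tensor ::
  "('h::complex_hilbert_space \<Rightarrow> 'k::complex_hilbert_space \<Rightarrow> 't::complex_hilbert_space) \<Rightarrow>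
    ('h \<Rightarrow>\<^sub>L 'h) \<Rightarrow> ('k \<Rightarrow>\<^sub>L 'k) \<Rightarrow> ('t \<Rightarrow>\<^sub>L 't)" where
  "op_tensor t S T = (THE X. X \<in> bounded_ops \<and> (\<forall>v w. X (t v w) = t (S v) (T w)))"

text \<open>Given \<open>t\<close> for \<open>H \<otimes> H\<close> and \<open>t3\<close> for \<open>(H \<otimes> H) \<otimes> H\<close>, this is the map
  \<open>H \<times> (H \<otimes> H) \<rightarrow> (H \<otimes> H) \<otimes> H\<close> sending \<open>(u, v \<otimes> w)\<close> to \<open>(u \<otimes> v) \<otimes> w\<close>, which makes the target the
  tensor product \<open>H \<otimes> (H \<otimes> H)\<close>.\<close>

definition reassoc ::
  "('h::complex_hilbert_space \<Rightarrow> 'h \<Rightarrow> 't::complex_hilbert_space) \<Rightarrow>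
    ('t \<Rightarrow> 'h \<Rightarrow> 's::complex_hilbert_space) \<Rightarrow> 'h \<Rightarrow> 't \<Rightarrow> 's" where
  "reassoc t t3 u =
    blinfun_apply (THE L. clinear_op L \<and> (\<forall>v w. L (t v w) = t3 (t u v) w))"

text \<open>The spatial tensor products \<open>A \<otimes> A\<close> and \<open>A \<otimes> A \<otimes> A\<close>, as norm-closed operator algebras via the
  faithful representation \<open>\<pi>\<close>.\<close>

definition spatial2 ::
  "('h::complex_hilbert_space \<Rightarrow> 'h \<Rightarrow> 't::complex_hilbert_space) \<Rightarrow>
    ('a::unital_cstar_algebra \<Rightarrow> 'h \<Rightarrow>\<^sub>L 'h) \<Rightarrow> ('t \<Rightarrow>\<^sub>L 't) set" where
  "spatial2 t \<pi> = closure (cspan {op_tensor t (\<pi> a) (\<pi> b) | a b. True})"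

definition spatial3 ::
  "('h::complex_hilbert_space \<Rightarrow> 'h \<Rightarrow> 't::complex_hilbert_space) \<Rightarrow>
    ('t \<Rightarrow> 'h \<Rightarrow> 's::complex_hilbert_space) \<Rightarrow>
    ('a::unital_cstar_algebra \<Rightarrow> 'h \<Rightarrow>\<^sub>L 'h) \<Rightarrow> ('s \<Rightarrow>\<^sub>L 's) set" where
  "spatial3 t t3 \<pi> =
    closure (cspan {op_tensor t3 (op_tensor t (\<pi> a) (\<pi> b)) (\<pi> c) | a b c. True})"

text \<open>The morphisms below are unique on \<open>spatial2 t \<pi>\<close>, because *-morphisms of C*-algebras are
  continuous; their values elsewhere are irrelevant.\<close>

definition flip_morphism ::
  "('h::complex_hilbert_space \<Rightarrow> 'h \<Rightarrow> 't::complex_hilbert_space) \<Rightarrow>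
    ('a::unital_cstar_algebra \<Rightarrow> 'h \<Rightarrow>\<^sub>L 'h) \<Rightarrow> ('t \<Rightarrow>\<^sub>L 't) \<Rightarrow> ('t \<Rightarrow>\<^sub>L 't)" where
  "flip_morphism t \<pi> = (SOME F.
    star_morphism (spatial2 t \<pi>) (spatial2 t \<pi>) F \<and>
    (\<forall>a b. F (op_tensor t (\<pi> a) (\<pi> b)) = op_tensor t (\<pi> b) (\<pi> a)))"

definition middle_morphism ::
  "('h::complex_hilbert_space \<Rightarrow> 'h \<Rightarrow> 't::complex_hilbert_space) \<Rightarrow>
    ('t \<Rightarrow> 'h \<Rightarrow> 's::complex_hilbert_space) \<Rightarrow>
    ('a::unital_cstar_algebra \<Rightarrow> 'h \<Rightarrow>\<^sub>L 'h) \<Rightarrow> ('t \<Rightarrow>\<^sub>L 't) \<Rightarrow> ('s \<Rightarrow>\<^sub>L 's)" where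
  "middle_morphism t t3 \<pi> = (SOME F.
    star_morphism (spatial2 t \<pi>) (spatial3 t t3 \<pi>) F \<and>
    (\<forall>a b. F (op_tensor t (\<pi> a) (\<pi> b)) =
      op_tensor t3 (op_tensor t (\<pi> a) (\<pi> 1)) (\<pi> b)))"

definition generated_vn ::
  "('a::unital_cstar_algebra \<Rightarrow> 'h::complex_hilbert_space \<Rightarrow>\<^sub>L 'h) \<Rightarrow> ('h \<Rightarrow>\<^sub>L 'h) set" where
  "generated_vn \<pi> = commutant (commutant (range \<pi>))"

definition vn_tensor ::
  "('h::complex_hilbert_space \<Rightarrow> 'k::complex_hilbert_space \<Rightarrow> 't::complex_hilbert_space) \<Rightarrow>
    ('h \<Rightarrow>\<^sub>L 'h) set \<Rightarrow> ('k \<Rightarrow>\<^sub>L 'k) set \<Rightarrow> ('t \<Rightarrow>\<^sub>L 't) set" where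
  "vn_tensor t M N = commutant (commutant {op_tensor t S T | S T. S \<in> M \<and> T \<in> N})"


section \<open>Compact quantum metric spaces\<close>

definition diag_proj ::
  "('h::complex_hilbert_space \<Rightarrow> 'h \<Rightarrow> 't::complex_hilbert_space) \<Rightarrow>
    ('a::unital_cstar_algebra \<Rightarrow> 'h \<Rightarrow>\<^sub>L 'h) \<Rightarrow> ('t \<Rightarrow>\<^sub>L 't)" where
  "diag_proj t \<pi> = (let M = generated_vn \<pi>; \<P> = projections_in (vn_tensor t M M) in
    THE P. P \<in> \<P> \<and>
      (\<forall>p\<in>minimal_projections M. op_le (op_tensor t p p) P) \<and>
      (\<forall>Q\<in>\<P>. (\<forall>p\<in>minimal_projections M. op_le (op_tensor t p p) Q) \<longrightarrow> op_le P Q))"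

definition off_diag ::
  "('h::complex_hilbert_space \<Rightarrow> 'h \<Rightarrow> 't::complex_hilbert_space) \<Rightarrow>
    ('a::unital_cstar_algebra \<Rightarrow> 'h \<Rightarrow>\<^sub>L 'h) \<Rightarrow> 't set" where
  "off_diag t \<pi> = orth_compl (range (blinfun_apply (diag_proj t \<pi>)))"

definition compact_quantum_metric_space ::
  "('h::complex_hilbert_space \<Rightarrow> 'h \<Rightarrow> 't::complex_hilbert_space) \<Rightarrow>
    ('t \<Rightarrow> 'h \<Rightarrow> 's::complex_hilbert_space) \<Rightarrow>
    ('t \<Rightarrow>\<^sub>L 't) \<Rightarrow> ('a::unital_cstar_algebra \<Rightarrow> 'h \<Rightarrow>\<^sub>L 'h) \<Rightarrow> bool" where
  "compact_quantum_metric_space t t3 \<rho> \<pi> \<longleftrightarrow>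
    faithful_atomic \<pi> \<and>
    \<rho> \<in> spatial2 t \<pi> \<and> positive_op \<rho> \<and>
    \<rho> o\<^sub>L diag_proj t \<pi> = 0 \<and> diag_proj t \<pi> o\<^sub>L \<rho> = 0 \<and>
    \<not> (\<exists>\<xi>\<in>off_diag t \<pi>. \<xi> \<noteq> 0 \<and> \<rho> \<xi> = 0) \<and>
    flip_morphism t \<pi> \<rho> = \<rho> \<and>
    op_le (middle_morphism t t3 \<pi> \<rho>)
      (op_tensor t3 \<rho> id_blinfun + op_tensor (reassoc t t3) id_blinfun \<rho>)"

text \<open>The operator norm of \<open>(a \<otimes> 1 - 1 \<otimes> a) \<rho>\<inverse>\<close>, whose domain is the (not necessarily closed) image
  of \<open>\<rho>\<close> restricted to \<open>off_diag t \<pi>\<close>; it may be infinite.\<close>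

definition lip_seminorm ::
  "('h::complex_hilbert_space \<Rightarrow> 'h \<Rightarrow> 't::complex_hilbert_space) \<Rightarrow>
    ('t \<Rightarrow>\<^sub>L 't) \<Rightarrow> ('a::unital_cstar_algebra \<Rightarrow> 'h \<Rightarrow>\<^sub>L 'h) \<Rightarrow> 'a \<Rightarrow> ennreal" where
  "lip_seminorm t \<rho> \<pi> a =
    (SUP \<eta>\<in>{\<eta> \<in> blinfun_apply \<rho> ` off_diag t \<pi>. norm \<eta> \<le> 1}.
      ennreal (norm ((op_tensor t (\<pi> a) id_blinfun - op_tensor t id_blinfun (\<pi> a))
        (inv_into (off_diag t \<pi>) (blinfun_apply \<rho>) \<eta>))))"

definition monge_kantorovich ::
  "('h::complex_hilbert_space \<Rightarrow> 'h \<Rightarrow> 't::complex_hilbert_space) \<Rightarrow>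
    ('t \<Rightarrow>\<^sub>L 't) \<Rightarrow> ('a::unital_cstar_algebra \<Rightarrow> 'h \<Rightarrow>\<^sub>L 'h) \<Rightarrow>
    ('a \<Rightarrow> complex) \<Rightarrow> ('a \<Rightarrow> complex) \<Rightarrow> ennreal" where
  "monge_kantorovich t \<rho> \<pi> \<phi> \<psi> =
    (SUP a\<in>{a. star a = a \<and> lip_seminorm t \<rho> \<pi> a \<le> 1}. ennreal (cmod (\<phi> a - \<psi> a)))"

end

theory Submission
  imports Defs
begin

text \<open>Write \<open>\<xi> = v \<otimes> w\<close>. For \<open>a\<close> in the algebra,
  \<open>\<langle>(a \<otimes> 1 - 1 \<otimes> a) \<xi>, \<xi>\<rangle> = \<phi>(a) - \<psi>(a)\<close>, so by Cauchy-Schwarz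
  \<open>\<bar>\<phi>(a) - \<psi>(a)\<bar> \<le> \<parallel>(a \<otimes> 1 - 1 \<otimes> a) \<xi>\<parallel>\<close>. If \<open>\<xi>\<close> is orthogonal to the range of the diagonal
  projection, a Lipschitz seminorm of at most \<open>1\<close> bounds the right-hand side by \<open>\<parallel>\<rho> \<xi>\<parallel>\<close>
  (\<open>lip_seminorm_bound\<close>), which is the claim. The work lies in the orthogonality
  (\<open>tensor_off_diag\<close>).

  The diagonal projection is the projection onto the closed span of the ranges of all
  \<open>p \<otimes> p\<close> with \<open>p\<close> a minimal projection of the von Neumann algebra \<open>M\<close> of the representation
  (\<open>ex_sup_projection\<close>, \<open>diag_proj_properties\<close>), so it suffices that \<open>p v = 0\<close> or
  \<open>p w = 0\<close> for each such \<open>p\<close>. The projections \<open>P\<^sub>i\<close> onto the irreducible summands are central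
  in \<open>M\<close>; minimality of \<open>p\<close> makes \<open>P\<^sub>i p\<close> either \<open>0\<close> or \<open>p\<close>, and since the summands
  containing \<open>v\<close> and \<open>w\<close> are orthogonal, \<open>p\<close> kills one of the two vectors
  (\<open>minimal_projection_kills\<close>). That \<open>P\<^sub>i\<close> lies in \<open>M\<close>, that is, commutes with the commutant,
  is where inequivalence enters: by Schur's lemma (\<open>schur_intertwiner\<close>) a nonzero intertwiner
  between two summands would be a multiple of a unitary (\<open>no_intertwiner\<close>).

  One analytic tool carries two of the steps: for a selfadjoint \<open>X\<close> of norm at most \<open>1\<close>, the
  operator \<open>1 - X\<close> has a positive square root that inherits every property of \<open>X\<close>
  which survives limits and one simple iteration (\<open>sqrt_one_minus\<close>). It replaces spectral theory
  in Schur's lemma, where \<open>B\<^sup>2 = T\<^sup>2\<close> gives \<open>(B - T) (B + T) = 0\<close>, and it shows that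
  \<open>S \<otimes> 1\<close> is bounded, with \<open>B\<^sup>2 = 1 - S\<^sup>* S\<close> (\<open>norm_tsum_contraction\<close>).\<close>

instance complex_hilbert_space \<subseteq> banach ..

section \<open>Inner products\<close>

lemma scaleR_scaleC: "r *\<^sub>R x = complex_of_real r *\<^sub>C (x::'a::complex_normed_vector)"
  by (simp add: scaleC_of_real)

lemma continuous_on_scaleC: "continuous_on A (\<lambda>y::'a::complex_normed_vector. c *\<^sub>C y)"
  by (rule linear_continuous_on, rule bounded_linear_intro[where K = "cmod c"])
    (simp_all add: scaleC_add_right scaleR_scaleC scaleC_scaleC norm_scaleC mult.commute)

context
  fixes x y z :: "'h::complex_hilbert_space"
begin

lemma cinner_add_right: "cinner x (y + z) = cinner x y + cinner x z"
  by (metis cinner_add_left cinner_commute complex_cnj_add)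

lemma cinner_scaleC_right: "cinner x (c *\<^sub>C y) = cnj c * cinner x y"
  by (metis cinner_scaleC_left cinner_commute complex_cnj_mult)

lemma cinner_scaleR_left: "cinner (r *\<^sub>R x) y = r *\<^sub>R cinner x y"
  by (simp add: scaleR_scaleC cinner_scaleC_left scaleR_conv_of_real)

lemma cinner_scaleR_right: "cinner x (r *\<^sub>R y) = r *\<^sub>R cinner x y"
  by (simp add: scaleR_scaleC cinner_scaleC_right scaleR_conv_of_real)

lemma Re_cinner_commute: "Re (cinner x y) = Re (cinner y x)"
  by (metis cinner_commute cnj.sel(1))

lemma norm_sq_cinner: "(norm x)\<^sup>2 = Re (cinner x x)"
  by (simp add: cinner_self)

end

lemma norm_add_sq:
  fixes x y :: "'h::complex_hilbert_space"
  shows "(norm (x + y))\<^sup>2 = (norm x)\<^sup>2 + (norm y)\<^sup>2 + 2 * Re (cinner x y)"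
  using Re_cinner_commute[of x y]
  by (simp add: norm_sq_cinner cinner_add_left cinner_add_right)

lemma cinner_Cauchy_Schwarz:
  fixes x y :: "'h::complex_hilbert_space"
  shows "cmod (cinner x y) \<le> norm x * norm y"
proof (cases "y = 0")
  case True
  have "cinner x (0 *\<^sub>R y) = 0"
    by (simp only: cinner_scaleR_right) simp
  then show ?thesis using True by simp
next
  case False
  let ?c = "cinner x y"
  have "0 \<le> (norm ((norm y)\<^sup>2 *\<^sub>R x + (- ?c) *\<^sub>C y))\<^sup>2" by simp
  also have "\<dots> = ((norm y)\<^sup>2 * norm x)\<^sup>2 + (cmod ?c * norm y)\<^sup>2
      + 2 * Re ((norm y)\<^sup>2 *\<^sub>R (- cnj ?c * ?c))"
    unfolding norm_add_sq norm_scaleC cinner_scaleR_left cinner_scaleC_right by simp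
  also have "Re ((norm y)\<^sup>2 *\<^sub>R (- cnj ?c * ?c)) = - ((norm y)\<^sup>2 * (cmod ?c)\<^sup>2)"
    using cmod_power2[of ?c] by (simp add: power2_eq_square)
  also have "((norm y)\<^sup>2 * norm x)\<^sup>2 + (cmod ?c * norm y)\<^sup>2 + 2 * - ((norm y)\<^sup>2 * (cmod ?c)\<^sup>2)
      = (norm y)\<^sup>2 * ((norm x * norm y)\<^sup>2 - (cmod ?c)\<^sup>2)"
    by (simp add: algebra_simps power2_eq_square)
  finally have "(cmod ?c)\<^sup>2 \<le> (norm x * norm y)\<^sup>2"
    using False by (simp add: zero_le_mult_iff)
  then show ?thesis by (rule power2_le_imp_le) simp
qed

lemma bounded_bilinear_cinner: "bounded_bilinear (cinner :: 'h::complex_hilbert_space \<Rightarrow> _)"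
  by (intro bounded_bilinear.intro exI[where x = 1])
    (auto simp: cinner_add_left cinner_add_right cinner_scaleR_left cinner_scaleR_right
      cinner_Cauchy_Schwarz)

global_interpretation cinner: bounded_bilinear "cinner :: 'h::complex_hilbert_space \<Rightarrow> _"
  by (rule bounded_bilinear_cinner)

lemma cinner_eq_zero_iff [simp]: "cinner x x = 0 \<longleftrightarrow> x = (0::'h::complex_hilbert_space)"
  by (simp add: cinner_self)

lemma cinner_eqI:
  fixes x y :: "'h::complex_hilbert_space"
  assumes "\<And>z. cinner x z = cinner y z"
  shows "x = y"
  using assms[of "x - y"] by (metis cinner.diff_left cinner_eq_zero_iff eq_iff_diff_eq_0)

lemma csubspace_scaleR: "csubspace V \<Longrightarrow> x \<in> V \<Longrightarrow> r *\<^sub>R x \<in> V"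
  for x :: "'a::complex_normed_vector"
  by (simp add: scaleR_scaleC complex_vector.subspace_scale)

text \<open>The extension principle used for all density arguments: a property that defines a closed
  subspace need only be checked on a total set.\<close>

lemma dense_cspan_subspace:
  fixes V :: "'a::complex_normed_vector set"
  assumes "closure (cspan S) = UNIV" "S \<subseteq> V" "csubspace V" "closed V"
  shows "x \<in> V"
proof -
  have "closure (cspan S) \<subseteq> V"
    using assms by (intro closure_minimal complex_vector.span_minimal)
  then show ?thesis using assms by auto
qed

lemma csubspace_Collect_cinner: "csubspace {x::'h::complex_hilbert_space. cinner x y = 0}"
  by (auto simp: complex_vector.subspace_def cinner_add_left cinner_scaleC_left cinner.zero_left)

lemma closed_Collect_cinner: "closed {x::'h::complex_hilbert_space. cinner x y = 0}"
  by (intro closed_Collect_eq cinner.continuous_on continuous_intros)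

lemma csubspace_orth_compl: "csubspace (orth_compl X)"
  by (auto simp: orth_compl_def complex_vector.subspace_def cinner_add_left cinner_scaleC_left
      cinner.zero_left)

section \<open>Riesz representation, projections and adjoints\<close>

text \<open>The representing vector minimizes \<open>\<parallel>x\<parallel>\<^sup>2 - 2 Re (f x)\<close> over \<open>V\<close>: by the parallelogram law a
  minimizing sequence is Cauchy, and the first variation at the minimum is the claim. Working on a
  subspace gives the orthogonal projection onto it (apply this to \<open>\<langle>\<cdot>, z\<rangle>\<close>), while the whole space
  gives adjoints.\<close>

lemma riesz_subspace:
  fixes V :: "'h::complex_hilbert_space set" and f :: "'h \<Rightarrow> complex"
  assumes V: "csubspace V" "closed V" and f: "bounded_linear f" and fC: "\<And>c x. f (c *\<^sub>C x) = c * f x"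
  shows "\<exists>y\<in>V. \<forall>x\<in>V. f x = cinner x y"
proof -
  interpret f: bounded_linear f by fact
  define J where "J x = (norm x)\<^sup>2 - 2 * Re (f x)" for x
  obtain C where C: "\<And>x. cmod (f x) \<le> norm x * C" using f.bounded by blast
  have lower: "- (C\<^sup>2) \<le> J x" for x
  proof -
    have "Re (f x) \<le> norm x * C" using C[of x] complex_Re_le_cmod[of "f x"] by linarith
    moreover have "0 \<le> (norm x - C)\<^sup>2" by simp
    ultimately show ?thesis by (simp add: J_def power2_eq_square algebra_simps)
  qed
  define m where "m = Inf (J ` V)"
  have bdd: "bdd_below (J ` V)" using lower by (intro bdd_belowI2)
  have m: "m \<le> J x" if "x \<in> V" for x unfolding m_def using that bdd by (intro cInf_lower) auto
  have V0: "V \<noteq> {}" using V(1) complex_vector.subspace_0 by blast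
  have "\<exists>x\<in>V. J x < m + 1 / real (Suc n)" for n
  proof -
    have "\<exists>z\<in>J ` V. z < m + 1 / real (Suc n)"
      using cInf_less_iff[of "J ` V" "m + 1 / real (Suc n)"] bdd V0 by (simp add: m_def)
    then show ?thesis by auto
  qed
  then obtain s where s: "\<And>n. s n \<in> V" "\<And>n. J (s n) < m + 1 / real (Suc n)" by metis
  have par: "(norm (x - y))\<^sup>2 \<le> 2 * (J x + J y - 2 * m)" if "x \<in> V" "y \<in> V" for x y
  proof -
    have "(1/2) *\<^sub>R (x + y) \<in> V"
      using V that by (intro csubspace_scaleR complex_vector.subspace_add)
    from m[OF this] have "m \<le> (norm (x + y))\<^sup>2 / 4 - Re (f x + f y)"
      by (simp add: J_def f.scaleR f.add power_divide add_divide_distrib)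
    moreover have "(norm (x - y))\<^sup>2 + (norm (x + y))\<^sup>2 = 2 * (norm x)\<^sup>2 + 2 * (norm y)\<^sup>2"
      using norm_add_sq[of x y] norm_add_sq[of x "- y"] by (simp add: cinner.minus_right)
    ultimately show ?thesis by (simp add: J_def)
  qed
  have "Cauchy s"
  proof (rule CauchyI)
    fix e :: real assume "e > 0"
    then obtain N where N: "N > 0" "4 / real N < e\<^sup>2"
    proof -
      obtain N :: nat where N: "4 / e\<^sup>2 < real N" using reals_Archimedean2 by blast
      moreover have "0 < 4 / e\<^sup>2" using \<open>e > 0\<close> by simp
      ultimately have "0 < real N" by linarith
      with N \<open>e > 0\<close> show ?thesis by (intro that[of N]) (simp_all add: field_simps)
    qed
    have "norm (s p - s q) < e" if "p \<ge> N" "q \<ge> N" for p q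
    proof -
      have *: "1 / real (Suc p) \<le> 1 / real N" "1 / real (Suc q) \<le> 1 / real N"
        using that N by (auto intro!: divide_left_mono)
      have "(norm (s p - s q))\<^sup>2 \<le> 2 * (J (s p) + J (s q) - 2 * m)" using par s by auto
      also have "\<dots> < 2 * (1 / real N + 1 / real N)" 
        using less_le_trans[OF s(2)[of p] add_left_mono[OF *(1)]]
          less_le_trans[OF s(2)[of q] add_left_mono[OF *(2)]] by simp
      also have "\<dots> < e\<^sup>2" using N by simp
      finally show ?thesis using \<open>e > 0\<close> by (simp add: power2_less_imp_less)
    qed
    then show "\<exists>M. \<forall>p\<ge>M. \<forall>q\<ge>M. norm (s p - s q) < e" by blast
  qed
  then obtain y where y: "s \<longlonglongrightarrow> y" using Cauchy_convergent_iff convergent_def by blast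
  have yV: "y \<in> V" using V(2) s(1) y closed_sequentially by blast
  have "(\<lambda>n. J (s n)) \<longlonglongrightarrow> J y" unfolding J_def by (intro tendsto_intros f.tendsto y)
  moreover have "(\<lambda>n. m + 1 / real (Suc n)) \<longlonglongrightarrow> m + 0"
    by (intro tendsto_intros LIMSEQ_Suc[OF lim_1_over_n])
  ultimately have "J y \<le> m + 0"
    by (rule LIMSEQ_le) (blast intro: less_imp_le[OF s(2)])
  then have min: "J y \<le> J x" if "x \<in> V" for x using m[OF that] by linarith
  have Re_eq: "Re (f x) = Re (cinner x y)" if x: "x \<in> V" for x
  proof -
    define D where "D = Re (cinner y x) - Re (f x)"
    have q: "0 \<le> 2 * (r * D) + r\<^sup>2 * (norm x)\<^sup>2" for r
    proof -
      have "J y \<le> J (y + r *\<^sub>R x)"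
        using V x yV by (intro min complex_vector.subspace_add csubspace_scaleR)
      then show ?thesis
        by (simp add: J_def D_def norm_add_sq f.add f.scaleR cinner_scaleR_right algebra_simps
            power_mult_distrib)
    qed
    have "D = 0"
    proof (rule ccontr)
      assume "D \<noteq> 0"
      define M where "M = (norm x)\<^sup>2 + 1"
      have M: "M > 0" "(norm x)\<^sup>2 < M" by (auto simp: M_def add_nonneg_pos)
      have "0 \<le> 2 * ((- D / M) * D) + (- D / M)\<^sup>2 * (norm x)\<^sup>2" by (rule q)
      also have "\<dots> \<le> 2 * ((- D / M) * D) + (- D / M)\<^sup>2 * M"
        using M by (intro add_left_mono mult_left_mono) auto
      also have "\<dots> = - (D\<^sup>2 / M)" using M by (simp add: power2_eq_square field_simps)
      also have "\<dots> < 0" using M \<open>D \<noteq> 0\<close> by simp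
      finally show False by simp
    qed
    then show ?thesis using Re_cinner_commute[of x y] by (simp add: D_def)
  qed
  \<comment> \<open>The imaginary part of a complex-linear functional at \<open>x\<close> is minus its real part at \<open>\<i> x\<close>.\<close>
  have "f x = cinner x y" if x: "x \<in> V" for x
  proof (rule complex_eqI)
    have "\<i> *\<^sub>C x \<in> V" using V x by (simp add: complex_vector.subspace_scale)
    from Re_eq[OF this] show "Im (f x) = Im (cinner x y)" by (simp add: fC cinner_scaleC_left)
  qed (rule Re_eq[OF x])
  then show ?thesis using yV by blast
qed

lemma bounded_opsD: "T \<in> bounded_ops \<Longrightarrow> T (c *\<^sub>C x) = c *\<^sub>C T x"
  by (simp add: bounded_ops_def clinear_op_def)

lemma is_adjointD: "is_adjoint S T \<Longrightarrow> cinner (S x) y = cinner x (T y)"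
  by (simp add: is_adjoint_def)

lemma is_adjoint_sym: "is_adjoint S T \<Longrightarrow> is_adjoint T S"
  by (simp add: is_adjoint_def) (metis cinner_commute)

lemma bounded_ops_diff: "S \<in> bounded_ops \<Longrightarrow> T \<in> bounded_ops \<Longrightarrow> S - T \<in> bounded_ops"
  by (simp add: bounded_ops_def clinear_op_def blinfun.diff_left complex_vector.scale_right_diff_distrib)

lemma bounded_ops_compose: "S \<in> bounded_ops \<Longrightarrow> T \<in> bounded_ops \<Longrightarrow> S o\<^sub>L T \<in> bounded_ops"
  by (simp add: bounded_ops_def clinear_op_def)

lemma ex_adjoint:
  fixes T :: "'h::complex_hilbert_space \<Rightarrow>\<^sub>L 'h"
  assumes T: "T \<in> bounded_ops"
  shows "\<exists>S\<in>bounded_ops. is_adjoint T S"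
proof -
  note TC = bounded_opsD[OF T]
  have "\<exists>z. \<forall>x. cinner (T x) y = cinner x z" for y
    using riesz_subspace[of UNIV "\<lambda>x. cinner (T x) y"]
    by (auto simp: TC cinner_scaleC_left complex_vector.subspace_UNIV
        intro!: bounded_linear_compose[OF cinner.bounded_linear_left] blinfun.bounded_linear_right)
  then obtain s where s: "\<And>x y. cinner (T x) y = cinner x (s y)" by metis
  have s': "cinner (s y) x = cinner y (T x)" for x y by (metis s cinner_commute)
  have "bounded_linear s"
  proof (rule bounded_linear_intro[where K = "norm T"])
    show "s (x + y) = s x + s y" for x y by (rule cinner_eqI) (simp add: s' cinner_add_left)
    show "s (r *\<^sub>R x) = r *\<^sub>R s x" for r x by (rule cinner_eqI) (simp add: s' cinner_scaleR_left)
    show "norm (s x) \<le> norm x * norm T" for x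
    proof (cases "s x = 0")
      case False
      have "(norm (s x))\<^sup>2 = cmod (cinner (s x) (s x))" by (simp add: cinner_self norm_power)
      also have "\<dots> = cmod (cinner x (T (s x)))" by (simp add: s')
      also have "\<dots> \<le> norm x * norm (T (s x))" by (rule cinner_Cauchy_Schwarz)
      also have "\<dots> \<le> norm x * (norm T * norm (s x))" by (intro mult_left_mono norm_blinfun) simp
      finally show ?thesis using False by (simp add: power2_eq_square)
    qed simp
  qed
  then have "blinfun_apply (Blinfun s) = s" by (rule bounded_linear_Blinfun_apply)
  moreover have "s (c *\<^sub>C x) = c *\<^sub>C s x" for c x
    by (rule cinner_eqI) (simp add: s' cinner_scaleC_left)
  ultimately show ?thesis
    by (intro bexI[of _ "Blinfun s"]) (auto simp: is_adjoint_def bounded_ops_def clinear_op_def s)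
qed

definition proj_on :: "'h::complex_hilbert_space set \<Rightarrow> ('h \<Rightarrow>\<^sub>L 'h) \<Rightarrow> bool" where
  "proj_on V P \<longleftrightarrow> P \<in> projections_in UNIV \<and> range (blinfun_apply P) = V"

lemma ex_proj_on:
  fixes V :: "'h::complex_hilbert_space set"
  assumes V: "csubspace V" "closed V"
  shows "\<exists>P. proj_on V P"
proof -
  have "\<exists>y\<in>V. \<forall>x\<in>V. cinner x z = cinner x y" for z
    using V by (intro riesz_subspace) (auto simp: cinner_scaleC_left cinner.bounded_linear_left)
  then obtain p where p: "\<And>z. p z \<in> V" "\<And>x z. x \<in> V \<Longrightarrow> cinner x z = cinner x (p z)" by metis
  have adj: "cinner (p x) y = cinner x (p y)" for x y by (metis p cinner_commute)
  have fixp: "p x = x" if "x \<in> V" for x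
  proof -
    have "p x - x \<in> V" using V that p by (simp add: complex_vector.subspace_diff)
    then have "cinner (p x - x) (p x - x) = 0" using p(2)[of "p x - x" x] by (simp add: cinner.diff_right)
    then show ?thesis by simp
  qed
  have "bounded_linear p"
  proof (rule bounded_linear_intro[where K = 1])
    show "p (x + y) = p x + p y" for x y by (rule cinner_eqI) (simp add: adj cinner_add_left)
    show "p (r *\<^sub>R x) = r *\<^sub>R p x" for r x by (rule cinner_eqI) (simp add: adj cinner_scaleR_left)
    show "norm (p x) \<le> norm x * 1" for x
    proof (cases "p x = 0")
      case False
      have "(norm (p x))\<^sup>2 = cmod (cinner (p x) (p x))" by (simp add: cinner_self norm_power)
      also have "\<dots> = cmod (cinner (p x) x)" using p by metis
      also have "\<dots> \<le> norm (p x) * norm x" by (rule cinner_Cauchy_Schwarz)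
      finally show ?thesis using False by (simp add: power2_eq_square)
    qed simp
  qed
  then have a: "blinfun_apply (Blinfun p) = p" by (rule bounded_linear_Blinfun_apply)
  have "p (c *\<^sub>C x) = c *\<^sub>C p x" for c x by (rule cinner_eqI) (simp add: adj cinner_scaleC_left)
  moreover have "range p = V" 
  proof
    show "V \<subseteq> range p" by (metis fixp range_eqI subsetI)
  qed (use p(1) in auto)
  ultimately have "proj_on V (Blinfun p)"
    unfolding proj_on_def projections_in_def bounded_ops_def is_adjoint_def clinear_op_def mem_Collect_eq a
    by (intro conjI blinfun_eqI) (simp_all add: a adj fixp p(1))
  then show ?thesis ..
qed

section \<open>Square roots\<close>

text \<open>The operator \<open>Y\<close> is the limit of the iteration \<open>Z \<mapsto> (X + Z\<^sup>2) / 2\<close> started at \<open>0\<close>; since \<open>2 Y = X + Y\<^sup>2\<close> says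
  \<open>(1 - Y)\<^sup>2 = 1 - X\<close>, the limit is \<open>1 - \<surd>(1 - X)\<close>. The increments are
  dominated by those of the scalar iteration for \<open>X = 1\<close>, which increases and is bounded by \<open>1\<close>.
  The last conclusion transfers to \<open>Y\<close> whatever a single iteration step preserves; selfadjointness,
  commutation relations and invariant subspaces are all obtained this way.\<close>

lemma sqrt_iteration:
  fixes X :: "'h::complex_hilbert_space \<Rightarrow>\<^sub>L 'h"
  assumes X: "norm X \<le> 1"
  obtains Y where "norm Y \<le> 1" "2 *\<^sub>R Y = X + (Y o\<^sub>L Y)"
    "\<And>\<C>. closed \<C> \<Longrightarrow> 0 \<in> \<C> \<Longrightarrow> (\<And>Z. Z \<in> \<C> \<Longrightarrow> (1/2) *\<^sub>R (X + (Z o\<^sub>L Z)) \<in> \<C>) \<Longrightarrow> Y \<in> \<C>"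
proof -
  define s where "s = rec_nat (0::'h \<Rightarrow>\<^sub>L 'h) (\<lambda>_ Z. (1/2) *\<^sub>R (X + (Z o\<^sub>L Z)))"
  define r where "r = rec_nat (0::real) (\<lambda>_ z. (1/2) * (1 + z * z))"
  have s: "s 0 = 0" "s (Suc n) = (1/2) *\<^sub>R (X + (s n o\<^sub>L s n))" for n by (simp_all add: s_def)
  have r: "r 0 = 0" "r (Suc n) = (1/2) * (1 + r n * r n)" for n by (simp_all add: r_def)
  have r01: "0 \<le> r n \<and> r n \<le> 1" for n
  proof (induction n)
    case (Suc n)
    then have "r n * r n \<le> 1" by (intro mult_le_one) auto
    then show ?case by (simp add: r)
  qed (simp add: r)
  have norm_s: "norm (s n) \<le> r n" for n
  proof (induction n)
    case (Suc n)
    have "norm (s n o\<^sub>L s n) \<le> r n * r n"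
      using Suc r01 by (intro order_trans[OF norm_blinfun_compose] mult_mono) auto
    then have "norm (X + (s n o\<^sub>L s n)) \<le> 1 + r n * r n"
      using X by (intro norm_triangle_le) auto
    then show ?case by (simp add: s r)
  qed (simp add: s r)
  have step: "norm (s (Suc n) - s n) \<le> r (Suc n) - r n" for n
  proof (induction n)
    case 0
    show ?case using X by (simp add: s r)
  next
    case (Suc n)
    let ?a = "s (Suc n)" and ?b = "s n"
    \<comment> \<open>Factor \<open>a\<^sup>2 - b\<^sup>2 = a (a - b) + (a - b) b\<close>, so that no commutation is needed.\<close>
    have "s (Suc (Suc n)) - ?a = (1/2) *\<^sub>R ((?a o\<^sub>L ?a) - (?b o\<^sub>L ?b))"
      unfolding s(2)[of "Suc n"] s(2)[of n] by (simp flip: scaleR_diff_right)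
    also have "(?a o\<^sub>L ?a) - (?b o\<^sub>L ?b) = (?a o\<^sub>L (?a - ?b)) + ((?a - ?b) o\<^sub>L ?b)"
      by (rule blinfun_eqI) (simp add: blinfun.bilinear_simps)
    finally have "norm (s (Suc (Suc n)) - ?a) \<le>
        (1/2) * (norm (?a o\<^sub>L (?a - ?b)) + norm ((?a - ?b) o\<^sub>L ?b))"
      by (simp add: norm_triangle_ineq)
    also have "\<dots> \<le> (1/2) * (r (Suc n) * (r (Suc n) - r n) + (r (Suc n) - r n) * r n)"
      using Suc order_trans[OF norm_ge_zero Suc] norm_s[of n] norm_s[of "Suc n"] r01[of "Suc n"]
      by (intro mult_left_mono add_mono order_trans[OF norm_blinfun_compose] mult_mono)
        (auto intro: order_trans[OF norm_ge_zero])
    also have "\<dots> = r (Suc (Suc n)) - r (Suc n)"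
      unfolding r(2)[of "Suc n"] r(2)[of n] by (simp add: algebra_simps)
    finally show ?case .
  qed
  have dist_s: "norm (s (n + k) - s n) \<le> r (n + k) - r n" for n k
  proof (induction k)
    case (Suc k)
    have "norm (s (n + Suc k) - s n) \<le> norm (s (Suc (n + k)) - s (n + k)) + norm (s (n + k) - s n)"
      by (metis add_Suc_right diff_add_cancel add_diff_eq norm_triangle_ineq)
    then show ?case using Suc step[of "n + k"] by simp
  qed simp
  have "incseq r" by (rule incseq_SucI) (metis step norm_ge_zero order_trans diff_ge_0_iff_ge)
  moreover have "bdd_above (range r)" using r01 by (intro bdd_aboveI2) auto
  ultimately have "convergent r" by (metis LIMSEQ_incseq_SUP convergentI)
  then have Cr: "Cauchy r" by (simp add: Cauchy_convergent_iff)
  have "Cauchy s"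
  proof (rule CauchyI')
    fix e :: real assume "e > 0"
    with Cr obtain M where M: "\<And>m n. m \<ge> M \<Longrightarrow> n \<ge> M \<Longrightarrow> dist (r m) (r n) < e"
      unfolding Cauchy_def by blast
    have "dist (s m) (s n) < e" if "m \<ge> M" "n > m" for m n
      using dist_s[of m "n - m"] M[of n m] that by (simp add: dist_norm norm_minus_commute)
    then show "\<exists>M. \<forall>m\<ge>M. \<forall>n>m. dist (s m) (s n) < e" by blast
  qed
  then obtain Y where Y: "s \<longlonglongrightarrow> Y" using Cauchy_convergent_iff convergent_def by blast
  show ?thesis
  proof (rule that)
    show "norm Y \<le> 1"
      using norm_s r01 by (intro Lim_norm_ubound[OF _ Y] always_eventually) (auto intro: order_trans)
    have "(\<lambda>n. 2 *\<^sub>R s (Suc n)) \<longlonglongrightarrow> 2 *\<^sub>R Y" by (intro tendsto_intros LIMSEQ_Suc Y)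
    moreover have "(\<lambda>n. 2 *\<^sub>R s (Suc n)) \<longlonglongrightarrow> X + (Y o\<^sub>L Y)"
      unfolding s by (simp, intro tendsto_intros Y)
    ultimately show "2 *\<^sub>R Y = X + (Y o\<^sub>L Y)" by (rule LIMSEQ_unique)
    fix \<C> assume C: "closed \<C>" "0 \<in> \<C>" "\<And>Z. Z \<in> \<C> \<Longrightarrow> (1/2) *\<^sub>R (X + (Z o\<^sub>L Z)) \<in> \<C>"
    have "s n \<in> \<C>" for n by (induction n) (use C in \<open>auto simp: s\<close>)
    then show "Y \<in> \<C>" using C(1) Y closed_sequentially by blast
  qed
qed

lemma closed_self_adjoint: "closed {Z::'h::complex_hilbert_space \<Rightarrow>\<^sub>L 'h. is_adjoint Z Z}"
  unfolding is_adjoint_def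
  by (intro closed_Collect_all closed_Collect_eq continuous_intros cinner.continuous_on)

lemma is_adjoint_iteration:
  assumes "is_adjoint X X" "is_adjoint Z Z"
  shows "is_adjoint ((1/2) *\<^sub>R (X + (Z o\<^sub>L Z))) ((1/2) *\<^sub>R (X + (Z o\<^sub>L Z)))"
  using assms unfolding is_adjoint_def
  by (simp add: blinfun.bilinear_simps cinner_add_left cinner_add_right cinner_scaleR_left
      cinner_scaleR_right)

text \<open>The square root of \<open>1 - X\<close> is \<open>1 - Y\<close>, and it is positive because \<open>\<parallel>Y\<parallel> \<le> 1\<close>.\<close>

lemma sqrt_one_minus:
  fixes X :: "'h::complex_hilbert_space \<Rightarrow>\<^sub>L 'h"
  assumes X: "norm X \<le> 1" "is_adjoint X X"
  obtains Y where "is_adjoint Y Y" "\<And>x. (x - Y x) - Y (x - Y x) = x - X x"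
    "\<And>x. 0 \<le> Re (cinner (x - Y x) x)"
    "\<And>\<C>. closed \<C> \<Longrightarrow> 0 \<in> \<C> \<Longrightarrow> (\<And>Z. Z \<in> \<C> \<Longrightarrow> (1/2) *\<^sub>R (X + (Z o\<^sub>L Z)) \<in> \<C>) \<Longrightarrow> Y \<in> \<C>"
proof -
  obtain Y where Y: "norm Y \<le> 1" "2 *\<^sub>R Y = X + (Y o\<^sub>L Y)"
    and cl: "\<And>\<C>. closed \<C> \<Longrightarrow> 0 \<in> \<C> \<Longrightarrow> (\<And>Z. Z \<in> \<C> \<Longrightarrow> (1/2) *\<^sub>R (X + (Z o\<^sub>L Z)) \<in> \<C>) \<Longrightarrow> Y \<in> \<C>"
    using sqrt_iteration[OF X(1)] by blast
  show ?thesis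
  proof (rule that[OF _ _ _ cl])
    have "is_adjoint (0 :: 'h \<Rightarrow>\<^sub>L 'h) 0"
      by (simp add: is_adjoint_def cinner.zero_left cinner.zero_right)
    then have "Y \<in> {Z. is_adjoint Z Z}"
      using is_adjoint_iteration[OF X(2)] by (intro cl closed_self_adjoint) simp_all
    then show "is_adjoint Y Y" by simp
    show "(x - Y x) - Y (x - Y x) = x - X x" for x
    proof -
      have "2 *\<^sub>R Y x = X x + Y (Y x)"
        using arg_cong[OF Y(2), of "\<lambda>T. blinfun_apply T x"] by (simp add: blinfun.bilinear_simps)
      then show ?thesis by (simp add: blinfun.bilinear_simps scaleR_2 algebra_simps)
    qed
    show "0 \<le> Re (cinner (x - Y x) x)" for x
    proof -
      have "Re (cinner (Y x) x) \<le> norm (Y x) * norm x"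
        by (rule order_trans[OF complex_Re_le_cmod cinner_Cauchy_Schwarz])
      also have "\<dots> \<le> norm x * norm x"
        using norm_blinfun[of Y x] mult_right_mono[OF Y(1), of "norm x"]
        by (intro mult_right_mono) auto
      finally show ?thesis by (simp add: cinner.diff_left cinner_self power2_eq_square)
    qed
  qed
qed

section \<open>Tensor products of operators\<close>

text \<open>A densely defined bounded operator given by its graph \<open>G\<close>. Bounding \<open>G\<close> as a relation makes
  well-definedness (which is hard to see on sums of elementary tensors) a consequence of the bound.\<close>

lemma extend_closed_graph:
  fixes G :: "('a::banach \<times> 'b::banach) set"
  assumes G: "subspace G" and bound: "\<And>x y. (x, y) \<in> G \<Longrightarrow> norm y \<le> C * norm x"
    and dense: "closure (fst ` G) = UNIV"
  obtains L :: "'a \<Rightarrow>\<^sub>L 'b" where "\<And>x. (x, L x) \<in> closure G" "\<And>x y. (x, y) \<in> closure G \<Longrightarrow> y = L x"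
proof -
  have sub: "subspace (closure G)"
  proof (rule subspaceI)
    show "0 \<in> closure G" using subspace_0[OF G] closure_subset by blast
    show "a + b \<in> closure G" if ab: "a \<in> closure G" "b \<in> closure G" for a b
    proof -
      obtain u v where "\<And>n. u n \<in> G" "u \<longlonglongrightarrow> a" "\<And>n. v n \<in> G" "v \<longlonglongrightarrow> b"
        using ab unfolding closure_sequential by blast
      then have "\<And>n. u n + v n \<in> G" "(\<lambda>n. u n + v n) \<longlonglongrightarrow> a + b"
        using subspace_add[OF G] by (auto intro: tendsto_add)
      then show ?thesis unfolding closure_sequential by (intro exI[of _ "\<lambda>n. u n + v n"]) auto
    qed
    show "c *\<^sub>R a \<in> closure G" if a: "a \<in> closure G" for c a
    proof -
      obtain u where "\<And>n. u n \<in> G" "u \<longlonglongrightarrow> a" using a unfolding closure_sequential by blast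
      then have "\<And>n. c *\<^sub>R u n \<in> G" "(\<lambda>n. c *\<^sub>R u n) \<longlonglongrightarrow> c *\<^sub>R a"
        using subspace_scale[OF G] by (auto intro: tendsto_scaleR)
      then show ?thesis unfolding closure_sequential by (intro exI[of _ "\<lambda>n. c *\<^sub>R u n"]) auto
    qed
  qed
  have "closure G \<subseteq> {z. norm (snd z) \<le> C * norm (fst z)}"
    using bound by (intro closure_minimal closed_Collect_le continuous_intros) auto
  then have bound': "norm y \<le> C * norm x" if "(x, y) \<in> closure G" for x y using that by auto
  have uniq: "y = y'" if "(x, y) \<in> closure G" "(x, y') \<in> closure G" for x y y'
    using bound'[of 0 "y - y'"] subspace_diff[OF sub that] by simp
  have ex: "\<exists>y. (x, y) \<in> closure G" for x
  proof -
    have "x \<in> closure (fst ` G)" using dense by simp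
    then obtain u where u: "\<And>n. u n \<in> fst ` G" "u \<longlonglongrightarrow> x" unfolding closure_sequential by blast
    then have "\<exists>y. (u n, y) \<in> G" for n by (metis imageE prod.collapse)
    then obtain w where w: "\<And>n. (u n, w n) \<in> G" by metis
    have *: "norm (w m - w n) \<le> C * norm (u m - u n)" for m n
      using bound subspace_diff[OF G w[of m] w[of n]] by simp
    have C: "norm (w m - w n) \<le> (\<bar>C\<bar> + 1) * norm (u m - u n)" for m n
      by (rule order_trans[OF *]) (intro mult_right_mono, auto)
    have "Cauchy w"
    proof (rule CauchyI)
      fix e :: real assume e: "e > 0"
      have "Cauchy u" using u(2) by (rule LIMSEQ_imp_Cauchy)
      moreover have "e / (\<bar>C\<bar> + 1) > 0" using e by (simp add: add_nonneg_pos)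
      ultimately obtain M where M: "\<And>m n. m \<ge> M \<Longrightarrow> n \<ge> M \<Longrightarrow> norm (u m - u n) < e / (\<bar>C\<bar> + 1)"
        using CauchyD by metis
      have "norm (w m - w n) < e" if "m \<ge> M" "n \<ge> M" for m n
        using M[OF that] C[of m n] by (simp add: pos_less_divide_eq add_nonneg_pos mult.commute)
      then show "\<exists>M. \<forall>m\<ge>M. \<forall>n\<ge>M. norm (w m - w n) < e" by blast
    qed
    then obtain y where "w \<longlonglongrightarrow> y" using Cauchy_convergent_iff convergent_def by blast
    then have "(\<lambda>n. (u n, w n)) \<longlonglongrightarrow> (x, y)" using u(2) by (intro tendsto_Pair)
    then have "(x, y) \<in> closure G"
      unfolding closure_sequential using w by (intro exI[of _ "\<lambda>n. (u n, w n)"]) auto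
    then show ?thesis by blast
  qed
  then obtain f where f: "\<And>x. (x, f x) \<in> closure G" by metis
  have "bounded_linear f"
  proof (rule bounded_linear_intro[where K = C])
    show "f (x + y) = f x + f y" for x y
      using uniq[OF f] subspace_add[OF sub f[of x] f[of y]] by simp
    show "f (r *\<^sub>R x) = r *\<^sub>R f x" for r x
      using uniq[OF f] subspace_scale[OF sub f[of x], of r] by simp
    show "norm (f x) \<le> norm x * C" for x using bound'[OF f[of x]] by (simp add: mult.commute)
  qed
  then have "blinfun_apply (Blinfun f) = f" by (rule bounded_linear_Blinfun_apply)
  then show ?thesis using f uniq by (intro that[of "Blinfun f"]) auto
qed

locale tensor_product =
  fixes t :: "'h::complex_hilbert_space \<Rightarrow> 'k::complex_hilbert_space \<Rightarrow> 't::complex_hilbert_space"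
  assumes hilbert_tensor: "hilbert_tensor t"
begin

lemma tensor_add_left: "t (v + v') w = t v w + t v' w"
  and tensor_scaleC_left: "t (c *\<^sub>C v) w = c *\<^sub>C t v w"
  and cinner_tensor: "cinner (t v w) (t v' w') = cinner v v' * cinner w w'"
  and dense_tensor: "closure (cspan (range (\<lambda>(v, w). t v w))) = UNIV"
  using hilbert_tensor by (simp_all add: hilbert_tensor_def)

lemma norm_tensor: "norm (t v w) = norm v * norm w"
proof -
  have "(norm (t v w))\<^sup>2 = (norm v * norm w)\<^sup>2"
    by (simp add: norm_sq_cinner cinner_tensor) (simp add: cinner_self power_mult_distrib)
  then show ?thesis by (simp add: power2_eq_iff_nonneg)
qed

lemma tensor_eqI:
  assumes "clinear_op X" "clinear_op Y" "\<And>v w. X (t v w) = Y (t v w)"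
  shows "X = (Y :: 't \<Rightarrow>\<^sub>L 'b::complex_normed_vector)"
proof (rule blinfun_eqI)
  fix x
  have "x \<in> {x. X x = Y x}"
  proof (rule dense_cspan_subspace[OF dense_tensor])
    show "csubspace {x. X x = Y x}"
      using assms by (auto simp: complex_vector.subspace_def clinear_op_def blinfun.bilinear_simps)
    show "closed {x. X x = Y x}" by (intro closed_Collect_eq continuous_intros)
  qed (use assms in auto)
  then show "X x = Y x" by simp
qed

text \<open>The image of \<open>\<Sum> v \<otimes> w\<close> under \<open>f \<otimes> 1\<close>, computed from a chosen list of elementary tensors, so
  that it makes sense before \<open>f \<otimes> 1\<close> is known to be well defined.\<close>

definition tsum :: "('h \<Rightarrow> 'h) \<Rightarrow> ('h \<times> 'k) list \<Rightarrow> 't" where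
  "tsum f xs = (\<Sum>(v, w)\<leftarrow>xs. t (f v) w)"

lemma tsum_simps [simp]:
  "tsum f [] = 0" "tsum f ((v, w) # xs) = t (f v) w + tsum f xs"
  "tsum f (xs @ ys) = tsum f xs + tsum f ys"
  by (simp_all add: tsum_def)

lemma cspan_tensor_tsum: "x \<in> cspan (range (\<lambda>(v, w). t v w)) \<Longrightarrow> \<exists>xs. x = tsum (\<lambda>v. v) xs"
proof (induction rule: complex_vector.span_induct_alt)
  case base
  show ?case by (rule exI[of _ "[]"]) simp
next
  case (step c x y)
  then obtain xs v w where "y = tsum (\<lambda>v. v) xs" "x = t v w" by auto
  then show ?case by (intro exI[of _ "(c *\<^sub>C v, w) # xs"]) (simp add: tensor_scaleC_left)
qed

lemma scaleC_tsum:
  assumes "\<And>v. f (c *\<^sub>C v) = c *\<^sub>C f v"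
  shows "c *\<^sub>C tsum f xs = tsum f (map (apfst (\<lambda>v. c *\<^sub>C v)) xs)"
  by (induction xs) (auto simp: scaleC_add_right tensor_scaleC_left assms)

lemma tsum_diff: "tsum (\<lambda>v. f v - g v) xs = tsum f xs - tsum g xs"
proof (induction xs)
  case (Cons a xs)
  have "t (f v - g v) w = t (f v) w - t (g v) w" for v w
    using tensor_add_left[of "f v - g v" "g v" w] by simp
  then show ?case using Cons by (cases a) simp
qed simp

lemma cinner_tsum_adjoint:
  assumes "is_adjoint S S'"
  shows "cinner (tsum (\<lambda>v. S (f v)) xs) (tsum g ys) = cinner (tsum f xs) (tsum (\<lambda>v. S' (g v)) ys)"
proof -
  have *: "cinner (t (S v) w) (tsum g ys) = cinner (t v w) (tsum (\<lambda>v. S' (g v)) ys)" for v w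
    by (induction ys)
      (auto simp: cinner_add_right cinner.zero_right cinner_tensor is_adjointD[OF assms])
  show ?thesis
    by (induction xs) (auto simp: cinner_add_left cinner.zero_left *)
qed

text \<open>With \<open>B\<close> the square root of \<open>1 - S\<^sup>* S\<close>, the difference of the squares of the two norms is
  \<open>\<parallel>\<Sum> B v \<otimes> w\<parallel>\<^sup>2 \<ge> 0\<close>; this avoids orthonormalizing the second factors.\<close>

lemma norm_tsum_contraction:
  assumes S: "S \<in> bounded_ops" "norm S \<le> 1"
  shows "norm (tsum S xs) \<le> norm (tsum (\<lambda>v. v) xs)"
proof -
  obtain S' where adj: "is_adjoint S S'" using ex_adjoint[OF S(1)] by blast
  have "norm S' \<le> 1"
  proof (rule norm_blinfun_bound)
    fix x
    have "(norm (S' x))\<^sup>2 = cmod (cinner (S (S' x)) x)"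
      by (simp add: is_adjointD[OF adj] cinner_self norm_power)
    also have "\<dots> \<le> norm (S (S' x)) * norm x" by (rule cinner_Cauchy_Schwarz)
    also have "\<dots> \<le> norm (S' x) * norm x"
      using norm_blinfun[of S "S' x"] mult_right_mono[OF S(2), of "norm (S' x)"]
      by (intro mult_right_mono) auto
    finally show "norm (S' x) \<le> 1 * norm x"
      by (cases "S' x = 0") (simp_all add: power2_eq_square)
  qed simp
  then have X: "norm (S' o\<^sub>L S) \<le> 1"
    using S(2) by (intro order_trans[OF norm_blinfun_compose] mult_le_one) auto
  have Xadj: "is_adjoint (S' o\<^sub>L S) (S' o\<^sub>L S)"
    using is_adjointD[OF adj] is_adjointD[OF is_adjoint_sym[OF adj]] by (simp add: is_adjoint_def)
  obtain Y where Y: "is_adjoint Y Y" "\<And>x. (x - Y x) - Y (x - Y x) = x - (S' o\<^sub>L S) x"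
    using sqrt_one_minus[OF X Xadj] by metis
  define B where "B = id_blinfun - Y"
  have B: "is_adjoint B B" "B (B x) = x - S' (S x)" for x
    using Y by (auto simp: B_def is_adjoint_def blinfun.bilinear_simps cinner.diff_left cinner.diff_right)
  have "0 \<le> Re (cinner (tsum B xs) (tsum B xs))"
    by (simp add: cinner_self)
  also have "\<dots> = Re (cinner (tsum (\<lambda>v. v) xs) (tsum (\<lambda>v. v - S' (S v)) xs))"
    by (simp add: cinner_tsum_adjoint[OF B(1)] B(2))
  also have "\<dots> = (norm (tsum (\<lambda>v. v) xs))\<^sup>2 - (norm (tsum S xs))\<^sup>2"
    by (simp add: tsum_diff cinner.diff_right norm_sq_cinner flip: cinner_tsum_adjoint[OF adj])
  finally have "(norm (tsum S xs))\<^sup>2 \<le> (norm (tsum (\<lambda>v. v) xs))\<^sup>2" by simp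
  then show ?thesis by (rule power2_le_imp_le) simp
qed

lemma ex_op_tensor_left:
  assumes S: "S \<in> bounded_ops"
  shows "\<exists>X. X \<in> bounded_ops \<and> (\<forall>v w. X (t v w) = t (S v) w)"
proof -
  define G where "G = {(tsum (\<lambda>v. v) xs, tsum S xs) | xs. True}"
  have scale: "(c *\<^sub>C x, c *\<^sub>C y) \<in> G" if xy: "(x, y) \<in> G" for c x y
  proof -
    obtain xs where xs: "x = tsum (\<lambda>v. v) xs" "y = tsum S xs" using xy by (auto simp: G_def)
    have "(c *\<^sub>C x, c *\<^sub>C y) =
        (tsum (\<lambda>v. v) (map (apfst (\<lambda>v. c *\<^sub>C v)) xs), tsum S (map (apfst (\<lambda>v. c *\<^sub>C v)) xs))"
      using bounded_opsD[OF S] by (simp add: xs scaleC_tsum)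
    then show ?thesis unfolding G_def by blast
  qed
  have subG: "subspace G"
  proof (rule subspaceI)
    show "0 \<in> G" unfolding G_def by (auto simp: zero_prod_def intro!: exI[of _ "[]"])
    show "a + b \<in> G" if ab: "a \<in> G" "b \<in> G" for a b
    proof -
      obtain xs ys where "a = (tsum (\<lambda>v. v) xs, tsum S xs)" "b = (tsum (\<lambda>v. v) ys, tsum S ys)"
        using ab by (auto simp: G_def)
      then have "a + b = (tsum (\<lambda>v. v) (xs @ ys), tsum S (xs @ ys))" by simp
      then show ?thesis unfolding G_def by blast
    qed
    show "c *\<^sub>R a \<in> G" if "a \<in> G" for c a using scale[of "fst a" "snd a" "of_real c"] that
      by (simp add: scaleC_of_real scaleR_prod_def)
  qed
  have boundG: "norm y \<le> norm S * norm x" if xy: "(x, y) \<in> G" for x y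
  proof (cases "S = 0")
    case True
    obtain xs where y: "y = tsum S xs" using xy by (auto simp: G_def)
    have "t 0 w = 0" for w using tensor_add_left[of 0 0 w] by simp
    then have "y = 0" unfolding y True by (induction xs) auto
    then show ?thesis by simp
  next
    case False
    obtain xs where xs: "x = tsum (\<lambda>v. v) xs" "y = tsum S xs" using xy by (auto simp: G_def)
    define R where "R = inverse (norm S) *\<^sub>R S"
    have R_apply: "R v = complex_of_real (inverse (norm S)) *\<^sub>C S v" for v
      by (simp add: R_def blinfun.bilinear_simps scaleC_of_real del: of_real_inverse)
    have R: "R \<in> bounded_ops" "norm R \<le> 1"
      using S False by (simp_all add: bounded_ops_def clinear_op_def R_apply scaleC_scaleC mult.commute)
        (simp add: R_def)
    have "inverse (norm S) *\<^sub>R y = tsum R xs"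
      unfolding xs(2) by (induction xs)
        (auto simp: R_apply scaleR_scaleC scaleC_add_right tensor_scaleC_left simp del: of_real_inverse)
    then have "norm (inverse (norm S) *\<^sub>R y) \<le> norm x"
      using norm_tsum_contraction[OF R, of xs] xs(1) by simp
    then show ?thesis using False by (simp add: field_simps)
  qed
  have "cspan (range (\<lambda>(v, w). t v w)) \<subseteq> fst ` G"
    using cspan_tensor_tsum by (force simp: G_def)
  then have "closure (fst ` G) = UNIV" using dense_tensor closure_mono by blast
  then obtain L :: "'t \<Rightarrow>\<^sub>L 't" where L: "\<And>x. (x, L x) \<in> closure G" "\<And>x y. (x, y) \<in> closure G \<Longrightarrow> y = L x"
    using extend_closed_graph[OF subG boundG] by blast
  have "L (c *\<^sub>C x) = c *\<^sub>C L x" for c x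
  proof -
    have "(\<lambda>z. (c *\<^sub>C fst z, c *\<^sub>C snd z)) ` closure G \<subseteq> closure G"
      by (rule image_closure_subset)
        (auto intro!: continuous_intros continuous_on_compose2[OF continuous_on_scaleC] closure_subset[THEN subsetD] scale)
    with L(1)[of x] show ?thesis by (intro L(2)[symmetric]) force
  qed
  moreover have "L (t v w) = t (S v) w" for v w
    by (rule L(2)[symmetric], rule closure_subset[THEN subsetD])
      (auto simp: G_def intro!: exI[of _ "[(v, w)]"])
  ultimately show ?thesis by (auto simp: bounded_ops_def clinear_op_def)
qed

end

text \<open>Reduces \<open>1 \<otimes> T\<close> to the case \<open>T \<otimes> 1\<close>.\<close>

lemma hilbert_tensor_swap:
  assumes "hilbert_tensor t"
  shows "hilbert_tensor (\<lambda>w v. t v w)"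
proof -
  have "range (\<lambda>(w, v). t v w) = range (\<lambda>(v, w). t v w)" by auto
  then show ?thesis using assms by (simp add: hilbert_tensor_def mult.commute)
qed

context tensor_product
begin

lemma ex1_op_tensor:
  assumes S: "S \<in> bounded_ops" and T: "T \<in> bounded_ops"
  shows "\<exists>!X. X \<in> bounded_ops \<and> (\<forall>v w. X (t v w) = t (S v) (T w))"
proof -
  obtain X where X: "X \<in> bounded_ops" "\<And>v w. X (t v w) = t (S v) w"
    using ex_op_tensor_left[OF S] by blast
  interpret swap: tensor_product "\<lambda>w v. t v w"
    by unfold_locales (rule hilbert_tensor_swap[OF hilbert_tensor])
  obtain Y where Y: "Y \<in> bounded_ops" "\<And>v w. Y (t v w) = t v (T w)"
    using swap.ex_op_tensor_left[OF T] by blast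
  have "X o\<^sub>L Y \<in> bounded_ops" using X Y by (auto simp: bounded_ops_def clinear_op_def)
  then show ?thesis
    using X Y by (intro ex1I[of _ "X o\<^sub>L Y"] tensor_eqI) (auto simp: bounded_ops_def)
qed

lemma op_tensor_bounded: "S \<in> bounded_ops \<Longrightarrow> T \<in> bounded_ops \<Longrightarrow> op_tensor t S T \<in> bounded_ops"
  and op_tensor_apply: "S \<in> bounded_ops \<Longrightarrow> T \<in> bounded_ops \<Longrightarrow> op_tensor t S T (t v w) = t (S v) (T w)"
  using theI'[OF ex1_op_tensor, of S T] by (auto simp: op_tensor_def)

end

section \<open>Projections\<close>

lemma projD:
  assumes "P \<in> projections_in M"
  shows "P \<in> bounded_ops" "P (P x) = P x" "cinner (P x) y = cinner x (P y)" "P \<in> M"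
    "is_adjoint P P"
  using assms by (auto simp: projections_in_def is_adjoint_def dest: arg_cong[where f = "\<lambda>T. blinfun_apply T x"])

lemma proj_fixes_range: "P \<in> projections_in M \<Longrightarrow> x \<in> range (blinfun_apply P) \<Longrightarrow> P x = x"
  by (auto simp: projD(2))

lemma proj_onD:
  assumes "proj_on V P"
  shows "P \<in> projections_in UNIV" "P x \<in> V" "x \<in> V \<Longrightarrow> P x = x" "range (blinfun_apply P) = V"
  using assms by (auto simp: proj_on_def projD)

lemma norm_sq_proj: "P \<in> projections_in M \<Longrightarrow> (norm x)\<^sup>2 = (norm (P x))\<^sup>2 + (norm (x - P x))\<^sup>2"
  using norm_add_sq[of "P x" "x - P x"]
  by (simp add: projD cinner.diff_right cinner.diff_left blinfun.diff_right cinner.zero_right)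

lemma norm_proj_le: "P \<in> projections_in M \<Longrightarrow> norm (P x) \<le> norm x"
  by (rule power2_le_imp_le) (simp_all add: norm_sq_proj[of P M x])

lemma proj_eq_if_norm_le: "P \<in> projections_in M \<Longrightarrow> norm x \<le> norm (P x) \<Longrightarrow> P x = x"
  using norm_sq_proj[of P M x] norm_proj_le[of P M x] by auto

lemma cinner_proj_self: "P \<in> projections_in M \<Longrightarrow> cinner (P x) x = of_real ((norm (P x))\<^sup>2)"
  using projD(2,3)[of P M] by (metis cinner_self)

text \<open>Both sides say that \<open>\<parallel>E x\<parallel> \<le> \<parallel>P x\<parallel>\<close> for all \<open>x\<close>: a projection fixes every vector whose norm it
  does not decrease.\<close>

lemma op_le_projections_iff:
  assumes E: "E \<in> projections_in M" and P: "P \<in> projections_in N"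
  shows "op_le E P \<longleftrightarrow> range (blinfun_apply E) \<subseteq> range (blinfun_apply P)"
proof -
  have le: "op_le E P \<longleftrightarrow> (\<forall>x. norm (E x) \<le> norm (P x))"
    using E P by (simp add: op_le_def positive_op_def bounded_ops_diff projD(1) blinfun.diff_left
        cinner.diff_left cinner_proj_self less_eq_complex_def power_mono_iff)
  show ?thesis
  proof
    assume "op_le E P"
    then have "norm (E x) \<le> norm (P (E x))" for x using le projD(2)[OF E] by metis
    then have "P (E x) = E x" for x using proj_eq_if_norm_le[OF P] by blast
    then show "range (blinfun_apply E) \<subseteq> range (blinfun_apply P)" by (metis image_subsetI rangeI)
  next
    assume "range (blinfun_apply E) \<subseteq> range (blinfun_apply P)"
    then have "P (E x) = E x" for x using projD(2)[OF P] by (metis imageE range_subsetD)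
    then have "E (P x) = E x" for x
      using projD(3)[OF E] projD(3)[OF P] by (intro cinner_eqI) metis
    then have "norm (E x) \<le> norm (P x)" for x using norm_proj_le[OF E, of "P x"] by simp
    then show "op_le E P" using le by simp
  qed
qed

lemma proj_eqI:
  assumes P: "P \<in> projections_in M" and Q: "Q \<in> projections_in N"
    and range: "range (blinfun_apply P) = range (blinfun_apply Q)"
  shows "P = Q"
proof (rule blinfun_eqI, rule cinner_eqI)
  fix x z
  have "P (Q y) = Q y" for y by (rule proj_fixes_range[OF P]) (simp add: range)
  moreover have "Q (P y) = P y" for y by (rule proj_fixes_range[OF Q]) (simp flip: range)
  ultimately show "cinner (P x) z = cinner (Q x) z" using projD(3)[OF P] projD(3)[OF Q] by metis
qed

lemma proj_commute:
  fixes T :: "'h::complex_hilbert_space \<Rightarrow>\<^sub>L 'h"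
  assumes P: "P \<in> projections_in M" and "\<And>x. P (T (P x)) = T (P x)" "\<And>x. P x = 0 \<Longrightarrow> P (T x) = 0"
  shows "T o\<^sub>L P = P o\<^sub>L T"
proof (rule blinfun_eqI)
  fix x
  have "P (T (x - P x)) = 0" by (rule assms(3)) (simp add: blinfun.diff_right projD(2)[OF P])
  then show "(T o\<^sub>L P) x = (P o\<^sub>L T) x" by (simp add: blinfun.diff_right assms(2))
qed

section \<open>Schur's lemma\<close>

definition irreducible_under :: "('h::complex_hilbert_space \<Rightarrow>\<^sub>L 'h) set \<Rightarrow> 'h set \<Rightarrow> bool" where
  "irreducible_under \<G> K \<longleftrightarrow> csubspace K \<and> closed K \<and> (\<forall>G\<in>\<G>. \<forall>x\<in>K. G x \<in> K) \<and>
    (\<forall>M. csubspace M \<and> closed M \<and> M \<subseteq> K \<and> (\<forall>G\<in>\<G>. \<forall>x\<in>M. G x \<in> M) \<longrightarrow> M = {0} \<or> M = K)"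

text \<open>The square root \<open>B\<close> of \<open>1 - (1 - T\<^sup>2)\<close> is \<open>\<bar>T\<bar>\<close>. It commutes with \<open>T\<close> and with \<open>\<G>\<close>, so the
  vectors of \<open>K\<close> with \<open>B x = T x\<close> form an invariant closed subspace containing the range of
  \<open>B + T\<close>. By irreducibility this subspace is everything, so \<open>T = B \<ge> 0\<close> on \<open>K\<close>, or it is zero, so
  \<open>T = - B \<le> 0\<close> on \<open>K\<close>.\<close>

lemma schur_sign:
  fixes T :: "'h::complex_hilbert_space \<Rightarrow>\<^sub>L 'h"
  assumes G: "\<G> \<subseteq> bounded_ops" and irr: "irreducible_under \<G> K"
    and T: "T \<in> bounded_ops" "is_adjoint T T" "\<And>x. x \<in> K \<Longrightarrow> T x \<in> K"
    and comm: "\<And>G x. G \<in> \<G> \<Longrightarrow> x \<in> K \<Longrightarrow> T (G x) = G (T x)" and norm: "norm T \<le> 1"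
  shows "(\<forall>x\<in>K. 0 \<le> Re (cinner (T x) x)) \<or> (\<forall>x\<in>K. Re (cinner (T x) x) \<le> 0)"
proof -
  have K: "csubspace K" "closed K" "\<And>G x. G \<in> \<G> \<Longrightarrow> x \<in> K \<Longrightarrow> G x \<in> K"
    using irr by (auto simp: irreducible_under_def)
  define X where "X = id_blinfun - (T o\<^sub>L T)"
  have X_apply: "X x = x - T (T x)" for x by (simp add: X_def blinfun.diff_left)
  have "norm X \<le> 1"
  proof (rule norm_blinfun_bound)
    fix x
    have Tle: "norm (T y) \<le> norm y" for y
      using norm_blinfun[of T y] mult_right_mono[OF norm, of "norm y"] by simp
    have "(norm (X x))\<^sup>2 = (norm x)\<^sup>2 + (norm (T (T x)))\<^sup>2 - 2 * (norm (T x))\<^sup>2"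
      using norm_add_sq[of x "- T (T x)"] is_adjointD[OF T(2), of x "T x"]
      by (simp add: X_apply cinner.minus_right norm_sq_cinner)
    also have "\<dots> \<le> (norm x)\<^sup>2"
    proof -
      have "(norm (T (T x)))\<^sup>2 \<le> (norm (T x))\<^sup>2" by (rule power_mono) (simp_all add: Tle)
      then show ?thesis using zero_le_power2[of "norm (T x)"] by linarith
    qed
    finally have "norm (X x) \<le> norm x" by (rule power2_le_imp_le) simp
    then show "norm (X x) \<le> 1 * norm x" by simp
  qed simp
  moreover have "is_adjoint X X"
    using is_adjointD[OF T(2)] by (simp add: is_adjoint_def X_apply cinner.diff_left cinner.diff_right)
  ultimately obtain Y :: "'h \<Rightarrow>\<^sub>L 'h" where Y: "\<And>x. (x - Y x) - Y (x - Y x) = x - X x"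
    "\<And>x. 0 \<le> Re (cinner (x - Y x) x)"
    and cl: "\<And>\<C>. closed \<C> \<Longrightarrow> 0 \<in> \<C> \<Longrightarrow> (\<And>Z. Z \<in> \<C> \<Longrightarrow> (1/2) *\<^sub>R (X + (Z o\<^sub>L Z)) \<in> \<C>) \<Longrightarrow> Y \<in> \<C>"
    using sqrt_one_minus by metis
  define \<C> where "\<C> = {Z :: 'h \<Rightarrow>\<^sub>L 'h. (\<forall>c. \<forall>x. Z (c *\<^sub>C x) = c *\<^sub>C Z x) \<and> (\<forall>x\<in>K. Z x \<in> K) \<and>
    (\<forall>G\<in>\<G>. \<forall>x\<in>K. Z (G x) = G (Z x)) \<and> (\<forall>x\<in>K. Z (T x) = T (Z x))}"
  have "Y \<in> \<C>"
  proof (rule cl)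
    have "closed {Z::'h \<Rightarrow>\<^sub>L 'h. Z x \<in> K}" for x
    proof -
      have "closed ((\<lambda>Z::'h \<Rightarrow>\<^sub>L 'h. Z x) -` K)"
        by (intro closed_vimage K continuous_intros)
      then show ?thesis by (simp add: vimage_def)
    qed
    then show "closed \<C>" unfolding \<C>_def Ball_def
      by (intro closed_Collect_conj closed_Collect_all closed_Collect_imp open_Collect_const
          closed_Collect_eq continuous_intros continuous_on_compose2[OF continuous_on_scaleC]) auto
    show "0 \<in> \<C>" using complex_vector.subspace_0[OF K(1)] by (simp add: \<C>_def)
    fix Z assume Z: "Z \<in> \<C>"
    let ?S = "(1/2) *\<^sub>R (X + (Z o\<^sub>L Z))"
    have S: "?S x = (1/2) *\<^sub>R (x - T (T x) + Z (Z x))" for x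
      by (simp add: blinfun.bilinear_simps X_apply)
    have Zs: "\<And>c x. Z (c *\<^sub>C x) = c *\<^sub>C Z x" "\<And>x. x \<in> K \<Longrightarrow> Z x \<in> K"
      "\<And>G x. G \<in> \<G> \<Longrightarrow> x \<in> K \<Longrightarrow> Z (G x) = G (Z x)" "\<And>x. x \<in> K \<Longrightarrow> Z (T x) = T (Z x)"
      using Z by (auto simp: \<C>_def)
    have "?S x \<in> K" if "x \<in> K" for x
      unfolding S using that T(3) Zs(2) K(1)
      by (intro csubspace_scaleR complex_vector.subspace_add complex_vector.subspace_diff) auto
    moreover have "?S (c *\<^sub>C x) = c *\<^sub>C ?S x" for c x
      unfolding S by (simp add: Zs bounded_opsD[OF T(1)] scaleR_scaleC scaleC_scaleC mult.commute
          scaleC_add_right complex_vector.scale_right_diff_distrib)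
    moreover have "?S (G x) = G (?S x)" if "G \<in> \<G>" "x \<in> K" for G x
      unfolding S using that by (simp add: Zs comm T(3) blinfun.bilinear_simps)
    moreover have "?S (T x) = T (?S x)" if "x \<in> K" for x
      unfolding S using that by (simp add: Zs blinfun.bilinear_simps)
    ultimately show "?S \<in> \<C>" by (simp add: \<C>_def)
  qed
  then have Ys: "\<And>c x. Y (c *\<^sub>C x) = c *\<^sub>C Y x" "\<And>x. x \<in> K \<Longrightarrow> Y x \<in> K"
      "\<And>G x. G \<in> \<G> \<Longrightarrow> x \<in> K \<Longrightarrow> Y (G x) = G (Y x)" "\<And>x. x \<in> K \<Longrightarrow> Y (T x) = T (Y x)"
    by (auto simp: \<C>_def)
  define N where "N = {x \<in> K. x - Y x = T x}"
  have "csubspace N"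
    unfolding complex_vector.subspace_def
  proof (intro conjI ballI allI)
    show "0 \<in> N" using complex_vector.subspace_0[OF K(1)] by (simp add: N_def blinfun.zero_right)
    show "x + y \<in> N" if xy: "x \<in> N" "y \<in> N" for x y
    proof -
      have "(x + y) - Y (x + y) = (x - Y x) + (y - Y y)" by (simp add: blinfun.add_right)
      also have "\<dots> = T (x + y)" using xy by (simp add: N_def blinfun.add_right)
      finally show ?thesis using xy complex_vector.subspace_add[OF K(1)] by (simp add: N_def)
    qed
    show "c *\<^sub>C x \<in> N" if x: "x \<in> N" for c x
    proof -
      have "c *\<^sub>C x - Y (c *\<^sub>C x) = c *\<^sub>C (x - Y x)"
        by (simp add: Ys complex_vector.scale_right_diff_distrib)
      also have "\<dots> = T (c *\<^sub>C x)" using x by (simp add: N_def bounded_opsD[OF T(1)])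
      finally show ?thesis using x complex_vector.subspace_scale[OF K(1)] by (simp add: N_def)
    qed
  qed
  moreover have "N = K \<inter> {x. x - Y x = T x}" by (auto simp: N_def)
  then have "closed N" using K(2) by (auto intro!: closed_Int closed_Collect_eq continuous_intros)
  moreover have "N \<subseteq> K" by (auto simp: N_def)
  moreover have "G x \<in> N" if "G \<in> \<G>" "x \<in> N" for G x
    using that by (auto simp: N_def K Ys comm simp flip: blinfun.diff_right)
  ultimately have N: "N = {0} \<or> N = K" using irr by (auto simp: irreducible_under_def)
  have inN: "(x - Y x) + T x \<in> N" if "x \<in> K" for x
  proof -
    have "(x - Y x) - Y (x - Y x) = T (T x)" using Y(1)[of x] by (simp add: X_apply)
    then show ?thesis using that K(1) T(3) Ys
      by (simp add: N_def complex_vector.subspace_add complex_vector.subspace_diff blinfun.bilinear_simps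
          algebra_simps)
  qed
  from N show ?thesis
  proof
    assume "N = {0}"
    then have "T x = - (x - Y x)" if "x \<in> K" for x
      using inN[OF that] \<open>N = {0}\<close> by (metis add.commute eq_neg_iff_add_eq_0 singletonD)
    then show ?thesis using Y(2) by (simp add: cinner.diff_left)
  next
    assume "N = K"
    then have "T x = x - Y x" if "x \<in> K" for x
      using that unfolding \<open>N = K\<close>[symmetric] by (simp add: N_def)
    then show ?thesis using Y(2) by simp
  qed
qed

text \<open>Every translate \<open>T - l\<close> has a definite sign on \<open>K\<close>; so two vectors with different values of
  \<open>\<langle>T x, x\<rangle> / \<parallel>x\<parallel>\<^sup>2\<close> are impossible, as a number \<open>l\<close> between them would contradict this. A constant
  numerical range forces \<open>T\<close> to be scalar by polarization.\<close>

lemma schur_scalar: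
  fixes T :: "'h::complex_hilbert_space \<Rightarrow>\<^sub>L 'h"
  assumes G: "\<G> \<subseteq> bounded_ops" and irr: "irreducible_under \<G> K"
    and T: "T \<in> bounded_ops" "is_adjoint T T" "\<And>x. x \<in> K \<Longrightarrow> T x \<in> K"
    and comm: "\<And>G x. G \<in> \<G> \<Longrightarrow> x \<in> K \<Longrightarrow> T (G x) = G (T x)"
  obtains c :: real where "\<And>x. x \<in> K \<Longrightarrow> T x = c *\<^sub>R x"
proof -
  have K: "csubspace K" using irr by (auto simp: irreducible_under_def)
  have sign: "(\<forall>x\<in>K. l * (norm x)\<^sup>2 \<le> Re (cinner (T x) x)) \<or> (\<forall>x\<in>K. Re (cinner (T x) x) \<le> l * (norm x)\<^sup>2)"
    for l
  proof -
    define n where "n = norm T + \<bar>l\<bar> + 1"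
    have n: "n > 0" by (simp add: n_def add_nonneg_pos)
    define R where "R = (1/n) *\<^sub>R (T - l *\<^sub>R id_blinfun)"
    have R_apply: "R x = (1/n) *\<^sub>R (T x - l *\<^sub>R x)" for x by (simp add: R_def blinfun.bilinear_simps)
    have "norm (T - l *\<^sub>R id_blinfun) \<le> norm T + \<bar>l\<bar> * 1"
      by (rule order_trans[OF norm_triangle_ineq4])
        (simp add: mult_left_le norm_blinfun_id_le)
    then have 1: "norm R \<le> 1" using n by (simp add: R_def n_def)
    have 2: "R \<in> bounded_ops"
      using bounded_opsD[OF T(1)] unfolding bounded_ops_def clinear_op_def
      by (simp add: R_apply scaleR_scaleC scaleC_scaleC complex_vector.scale_right_diff_distrib mult.commute mult.left_commute)
    have 3: "is_adjoint R R" using is_adjointD[OF T(2)]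
      by (simp add: is_adjoint_def R_apply cinner.diff_left cinner.diff_right cinner_scaleR_left cinner_scaleR_right)
    have 4: "R x \<in> K" if "x \<in> K" for x
      unfolding R_apply using that T(3) K
      by (intro csubspace_scaleR complex_vector.subspace_diff) auto
    have 5: "R (G x) = G (R x)" if "G \<in> \<G>" "x \<in> K" for G x
      by (simp add: R_apply comm[OF that] blinfun.bilinear_simps)
    have "Re (cinner (R x) x) = (1/n) * (Re (cinner (T x) x) - l * (norm x)\<^sup>2)" for x
      by (simp add: R_apply cinner_scaleR_left cinner.diff_left cinner_self)
    then show ?thesis using schur_sign[OF G irr 2 3 4 5 1] n
      by (simp add: zero_le_divide_iff divide_le_0_iff)
  qed
  show ?thesis
  proof (cases "\<exists>y\<in>K. y \<noteq> 0")
    case False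
    then show ?thesis by (intro that[of 0]) (auto simp: blinfun.zero_right)
  next
    case True
    then obtain y where y: "y \<in> K" "y \<noteq> 0" by blast
    define c where "c = Re (cinner (T y) y) / (norm y)\<^sup>2"
    have y_eq: "Re (cinner (T y) y) = c * (norm y)\<^sup>2" using y by (simp add: c_def)
    have quad: "Re (cinner (T x) x) = c * (norm x)\<^sup>2" if x: "x \<in> K" for x
    proof (cases "x = 0")
      case False
      define b where "b = Re (cinner (T x) x) / (norm x)\<^sup>2"
      have x_eq: "Re (cinner (T x) x) = b * (norm x)\<^sup>2" using False by (simp add: b_def)
      have pos: "(norm x)\<^sup>2 > 0" "(norm y)\<^sup>2 > 0" using False y by simp_all
      have "((b + c) / 2 \<le> b \<and> (b + c) / 2 \<le> c) \<or> (b \<le> (b + c) / 2 \<and> c \<le> (b + c) / 2)"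
        using sign[of "(b + c) / 2"] x y(1) x_eq y_eq pos by (metis mult_le_cancel_right_pos)
      then have "b = c" by (auto simp: field_simps)
      then show ?thesis using x_eq by simp
    qed (simp add: cinner.zero_right)
    define D where "D = T - c *\<^sub>R id_blinfun"
    have D_apply: "D x = T x - c *\<^sub>R x" for x by (simp add: D_def blinfun.bilinear_simps)
    have D0: "Re (cinner (D x) x) = 0" if "x \<in> K" for x
      using quad[OF that] by (simp add: D_apply cinner.diff_left cinner_scaleR_left cinner_self)
    have Dsym: "cinner (D x) y = cinner x (D y)" for x y
      by (simp add: D_apply cinner.diff_left cinner.diff_right cinner_scaleR_left cinner_scaleR_right
          is_adjointD[OF T(2)])
    have "D x = 0" if x: "x \<in> K" for x
    proof -
      have Dx: "D x \<in> K" unfolding D_apply using x T(3) K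
        by (intro csubspace_scaleR complex_vector.subspace_diff) auto
      have "Re (cinner (D (x + D x)) (x + D x)) = 0"
        using D0 complex_vector.subspace_add[OF K x Dx] by blast
      then have "Re (cinner (D x) (D x)) + Re (cinner (D (D x)) x) = 0"
        using D0[OF x] D0[OF Dx] by (simp add: blinfun.add_right cinner_add_left cinner_add_right)
      then show ?thesis using Dsym[of "D x" x] by (simp add: cinner_self)
    qed
    then show ?thesis by (intro that[of c]) (simp add: D_apply)
  qed
qed

text \<open>\<open>S\<^sup>* S\<close> commutes with \<open>\<G>\<close> and preserves \<open>K\<close>, because \<open>S\<close> vanishes on the orthogonal complement
  of \<open>K\<close>; hence it is scalar there, and \<open>S\<close> multiplies norms by a constant. The image of \<open>K\<close> is
  then closed, and by irreducibility it is all of \<open>L\<close>.\<close>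

lemma schur_intertwiner:
  fixes S :: "'h::complex_hilbert_space \<Rightarrow>\<^sub>L 'h"
  assumes G: "\<G> \<subseteq> bounded_ops" and adj: "\<And>G. G \<in> \<G> \<Longrightarrow> \<exists>G'\<in>\<G>. is_adjoint G G'"
    and irr: "irreducible_under \<G> K" "irreducible_under \<G> L"
    and S: "S \<in> commutant \<G>" "\<And>x. x \<in> K \<Longrightarrow> S x \<in> L"
    and P: "proj_on K P" "\<And>x. S (P x) = S x"
    and nz: "x\<^sub>0 \<in> K" "S x\<^sub>0 \<noteq> 0"
  obtains c where "c > 0" "\<And>x. x \<in> K \<Longrightarrow> norm (S x) = c * norm x" "S ` K = L"
proof -
  have Sb: "S \<in> bounded_ops" and Sc: "\<And>G x. G \<in> \<G> \<Longrightarrow> S (G x) = G (S x)"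
    using S(1) unfolding commutant_def by (auto dest: arg_cong[where f = "\<lambda>T. blinfun_apply T _"])
      (metis blinfun_apply_blinfun_compose)
  obtain S' where S': "S' \<in> bounded_ops" "is_adjoint S S'" using ex_adjoint[OF Sb] by blast
  note S'D = is_adjointD[OF S'(2)] and SD = is_adjointD[OF is_adjoint_sym[OF S'(2)]]
  have S'c: "S' (G x) = G (S' x)" if GG: "G \<in> \<G>" for G x
  proof (rule cinner_eqI)
    fix z
    obtain G' where G': "G' \<in> \<G>" "is_adjoint G G'" using adj[OF GG] by blast
    show "cinner (S' (G x)) z = cinner (G (S' x)) z"
      by (simp add: SD is_adjointD[OF G'(2)] Sc[OF G'(1)])
  qed
  define A where "A = S' o\<^sub>L S"
  have PK: "P (S' x) = S' x" for x
    by (rule cinner_eqI) (simp add: projD(3)[OF proj_onD(1)[OF P(1)]] SD P(2))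
  have "A \<in> bounded_ops" using Sb S'(1) by (simp add: A_def bounded_ops_def clinear_op_def)
  moreover have "is_adjoint A A" by (simp add: is_adjoint_def A_def SD S'D)
  moreover have "A x \<in> K" for x using proj_onD(2)[OF P(1), of "A x"] by (simp add: A_def PK)
  moreover have "A (H x) = H (A x)" if "H \<in> \<G>" for H x using that by (simp add: A_def Sc S'c)
  ultimately obtain c where c: "\<And>x. x \<in> K \<Longrightarrow> A x = c *\<^sub>R x"
    using schur_scalar[OF G irr(1), of A] by metis
  have norm_sq: "(norm (S x))\<^sup>2 = c * (norm x)\<^sup>2" if "x \<in> K" for x
  proof -
    have "(norm (S x))\<^sup>2 = Re (cinner (A x) x)" by (simp add: norm_sq_cinner A_def SD)
    then show ?thesis by (simp add: c[OF that] cinner_scaleR_left cinner_self)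
  qed
  have "0 < c * (norm x\<^sub>0)\<^sup>2" using norm_sq[OF nz(1)] nz(2) by (metis zero_less_norm_iff zero_less_power)
  then have cpos: "c > 0" by (simp add: zero_less_mult_iff)
  have norm: "norm (S x) = sqrt c * norm x" if "x \<in> K" for x
    using norm_sq[OF that] cpos by (metis norm_ge_zero real_sqrt_abs abs_of_nonneg real_sqrt_mult)
  have K: "csubspace K" "closed K" using irr(1) by (auto simp: irreducible_under_def)
  have "complete (S ` K)"
  proof (rule complete_isometric_image[where e = "sqrt c"])
    show "subspace K" using K(1) csubspace_scaleR[OF K(1)]
      by (intro subspaceI) (auto simp: complex_vector.subspace_def)
  qed (use cpos norm K in \<open>auto simp: complete_eq_closed blinfun.bounded_linear_right\<close>)
  then have "closed (S ` K)" by (simp add: complete_eq_closed)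
  moreover have "csubspace (S ` K)"
    unfolding complex_vector.subspace_def
  proof (intro conjI ballI allI)
    show "0 \<in> S ` K" using complex_vector.subspace_0[OF K(1)] by (metis blinfun.zero_right imageI)
    show "a + b \<in> S ` K" if "a \<in> S ` K" "b \<in> S ` K" for a b
      using that complex_vector.subspace_add[OF K(1)] by (auto simp flip: blinfun.add_right)
    show "c *\<^sub>C a \<in> S ` K" if "a \<in> S ` K" for a c
      using that complex_vector.subspace_scale[OF K(1)] by (auto simp flip: bounded_opsD[OF Sb])
  qed
  moreover have "S ` K \<subseteq> L" using S(2) by auto
  moreover have "H y \<in> S ` K" if "H \<in> \<G>" "y \<in> S ` K" for H y
    using that irr(1) by (auto simp: irreducible_under_def simp flip: Sc)
  ultimately have "S ` K = {0} \<or> S ` K = L" using irr(2) by (simp add: irreducible_under_def)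
  moreover have "S ` K \<noteq> {0}" using nz by blast
  ultimately have "S ` K = L" by blast
  then show ?thesis using that[of "sqrt c"] cpos norm by auto
qed

section \<open>Central projections of an atomic representation\<close>

lemma commutantD: "T \<in> commutant M \<Longrightarrow> S \<in> M \<Longrightarrow> T (S x) = S (T x)"
  for M :: "('h::complex_hilbert_space \<Rightarrow>\<^sub>L 'h) set"
  unfolding commutant_def by (metis (mono_tags, lifting) blinfun_apply_blinfun_compose mem_Collect_eq)

lemma commutantI: "T \<in> bounded_ops \<Longrightarrow> (\<And>S x. S \<in> M \<Longrightarrow> T (S x) = S (T x)) \<Longrightarrow> T \<in> commutant M"
  for M :: "('h::complex_hilbert_space \<Rightarrow>\<^sub>L 'h) set"
  by (auto simp: commutant_def intro!: blinfun_eqI)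

lemma commutant_bounded: "T \<in> commutant M \<Longrightarrow> T \<in> bounded_ops"
  by (simp add: commutant_def)

lemma commutant_compose: "S \<in> commutant M \<Longrightarrow> T \<in> commutant M \<Longrightarrow> S o\<^sub>L T \<in> commutant M"
  by (intro commutantI bounded_ops_compose) (auto simp: commutant_bounded commutantD)

locale atomic_rep =
  fixes I :: "'i set" and K :: "'i \<Rightarrow> 'h::complex_hilbert_space set"
    and r :: "'i \<Rightarrow> 'a::unital_cstar_algebra \<Rightarrow> 'h \<Rightarrow> 'h" and \<pi> :: "'a \<Rightarrow> 'h \<Rightarrow>\<^sub>L 'h"
  assumes atomic: "atomic_decomposition I K r \<pi>"
    and rep: "representation_on UNIV (\<lambda>a. blinfun_apply (\<pi> a))"
begin

lemma rep_bounded: "\<pi> a \<in> bounded_ops"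
  using rep by (simp add: representation_on_def bounded_ops_def clinear_op_def)

lemma rep_adjoint: "is_adjoint (\<pi> a) (\<pi> (star a))"
  using rep by (simp add: representation_on_def is_adjoint_def)

lemma rep_summand: "i \<in> I \<Longrightarrow> x \<in> K i \<Longrightarrow> \<pi> a x = r i a x"
  using atomic by (simp add: atomic_decomposition_def direct_sum_rep_def)

lemma summand:
  assumes "i \<in> I"
  shows "csubspace (K i)" "closed (K i)" "x \<in> K i \<Longrightarrow> \<pi> a x \<in> K i"
proof -
  have "representation_on (K i) (r i)"
    using assms atomic by (auto simp: atomic_decomposition_def direct_sum_rep_def)
  then show "csubspace (K i)" "closed (K i)" "x \<in> K i \<Longrightarrow> \<pi> a x \<in> K i"
    using rep_summand[OF assms] by (simp_all add: representation_on_def)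
qed

lemma summands_orthogonal: "i \<in> I \<Longrightarrow> j \<in> I \<Longrightarrow> i \<noteq> j \<Longrightarrow> x \<in> K i \<Longrightarrow> y \<in> K j \<Longrightarrow> cinner x y = 0"
  using atomic by (simp add: atomic_decomposition_def direct_sum_rep_def)

lemma summands_dense: "closure (cspan (\<Union>i\<in>I. K i)) = UNIV"
  using atomic by (simp add: atomic_decomposition_def direct_sum_rep_def)

lemma summand_irreducible: "i \<in> I \<Longrightarrow> irreducible_under (range \<pi>) (K i)"
proof -
  assume i: "i \<in> I"
  then have "irreducible_on (K i) (r i)" using atomic by (simp add: atomic_decomposition_def)
  then have "\<forall>M. csubspace M \<and> closed M \<and> M \<subseteq> K i \<and> (\<forall>a. \<forall>x\<in>M. r i a x \<in> M) \<longrightarrow> M = {0} \<or> M = K i"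
    by (simp add: irreducible_on_def)
  moreover have "(\<forall>a. \<forall>x\<in>M. r i a x \<in> M) \<longleftrightarrow> (\<forall>a. \<forall>x\<in>M. \<pi> a x \<in> M)" if "M \<subseteq> K i" for M
    using rep_summand[OF i] that by (metis subsetD)
  ultimately show ?thesis using summand[OF i] by (simp add: irreducible_under_def)
qed

definition summand_proj :: "'i \<Rightarrow> 'h \<Rightarrow>\<^sub>L 'h" where
  "summand_proj i = (SOME p. proj_on (K i) p)"

lemma proj_on_summand: "i \<in> I \<Longrightarrow> proj_on (K i) (summand_proj i)"
  unfolding summand_proj_def by (rule someI_ex, rule ex_proj_on) (simp_all add: summand)

lemmas summand_proj_projection = proj_onD(1)[OF proj_on_summand]

lemma summand_proj_eq_zero: "i \<in> I \<Longrightarrow> summand_proj i x = 0 \<longleftrightarrow> (\<forall>y\<in>K i. cinner x y = 0)"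
  using proj_onD[OF proj_on_summand[of i]] projD(3)[OF summand_proj_projection[of i]]
  by (metis cinner.zero_left cinner_eq_zero_iff)

lemma summand_proj_orthogonal: "i \<in> I \<Longrightarrow> j \<in> I \<Longrightarrow> i \<noteq> j \<Longrightarrow> x \<in> K j \<Longrightarrow> summand_proj i x = 0"
  using summand_proj_eq_zero summands_orthogonal by metis

lemma summand_proj_commutant: "i \<in> I \<Longrightarrow> summand_proj i \<in> commutant (range \<pi>)"
proof (rule commutantI)
  assume i: "i \<in> I"
  show "summand_proj i \<in> bounded_ops" using projD(1)[OF summand_proj_projection[OF i]] .
  fix S x assume "S \<in> range \<pi>"
  then obtain a where S: "S = \<pi> a" by blast
  have "\<pi> a o\<^sub>L summand_proj i = summand_proj i o\<^sub>L \<pi> a"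
  proof (rule proj_commute[OF summand_proj_projection[OF i]])
    show "summand_proj i (\<pi> a (summand_proj i x)) = \<pi> a (summand_proj i x)" for x
      using proj_onD[OF proj_on_summand[OF i]] summand(3)[OF i] by blast
    show "summand_proj i (\<pi> a x) = 0" if "summand_proj i x = 0" for x
      using that summand(3)[OF i] by (auto simp: summand_proj_eq_zero[OF i] is_adjointD[OF rep_adjoint])
  qed
  then show "summand_proj i (S x) = S (summand_proj i x)" using S by (metis blinfun_apply_blinfun_compose)
qed

text \<open>Otherwise the compression of \<open>T\<close> to a map between the two summands, suitably rescaled, would be
  a unitary equivalence.\<close>

lemma no_intertwiner:
  assumes i: "i \<in> I" and j: "j \<in> I" and "i \<noteq> j" and T: "T \<in> commutant (range \<pi>)" and x: "x \<in> K i"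
  shows "summand_proj j (T x) = 0"
proof (rule ccontr)
  assume nz: "summand_proj j (T x) \<noteq> 0"
  define S where "S = summand_proj j o\<^sub>L T o\<^sub>L summand_proj i"
  have S: "S \<in> commutant (range \<pi>)"
    unfolding S_def using summand_proj_commutant i j T by (intro commutant_compose)
  have Sx: "S x \<noteq> 0" using nz proj_onD(3)[OF proj_on_summand[OF i] x] by (simp add: S_def)
  have SL: "S y \<in> K j" for y using proj_onD(2)[OF proj_on_summand[OF j]] by (simp add: S_def)
  have SP: "S (summand_proj i y) = S y" for y using projD(2)[OF summand_proj_projection[OF i]] by (simp add: S_def)
  have G: "range \<pi> \<subseteq> bounded_ops" using rep_bounded by blast
  have adj: "\<exists>G'\<in>range \<pi>. is_adjoint G G'" if "G \<in> range \<pi>" for G using that rep_adjoint by blast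
  obtain c where c: "c > 0" "\<And>y. y \<in> K i \<Longrightarrow> norm (S y) = c * norm y" "S ` K i = K j"
    using schur_intertwiner[OF G adj summand_irreducible[OF i] summand_irreducible[OF j] S SL
        proj_on_summand[OF i] SP x Sx] by blast
  have "unitarily_equivalent (K i) (r i) (K j) (r j)"
    unfolding unitarily_equivalent_def
  proof (intro exI[of _ "\<lambda>y. (1/c) *\<^sub>R S y"] conjI ballI allI)
    show "(\<lambda>y. (1 / c) *\<^sub>R S y) ` K i = K j"
    proof -
      have "(\<lambda>y. (1 / c) *\<^sub>R y) ` K j = K j"
      proof
        show "(\<lambda>y. (1 / c) *\<^sub>R y) ` K j \<subseteq> K j"
          using csubspace_scaleR[OF summand(1)[OF j]] by auto
        show "K j \<subseteq> (\<lambda>y. (1 / c) *\<^sub>R y) ` K j"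
        proof
          fix y assume "y \<in> K j"
          then have "c *\<^sub>R y \<in> K j" using csubspace_scaleR[OF summand(1)[OF j]] by blast
          then show "y \<in> (\<lambda>y. (1 / c) *\<^sub>R y) ` K j" using c(1) by (intro image_eqI[of _ _ "c *\<^sub>R y"]) auto
        qed
      qed
      then show ?thesis using c(3) by (metis image_image)
    qed
    fix a y assume y: "y \<in> K i"
    have "(1/c) *\<^sub>R S y \<in> K j" using csubspace_scaleR[OF summand(1)[OF j]] SL by blast
    then have "r j a ((1/c) *\<^sub>R S y) = \<pi> a ((1/c) *\<^sub>R S y)" using rep_summand[OF j] by metis
    also have "\<dots> = (1/c) *\<^sub>R S (\<pi> a y)" using commutantD[OF S] by (simp add: blinfun.scaleR_right)
    finally show "(1/c) *\<^sub>R S (r i a y) = r j a ((1/c) *\<^sub>R S y)" by (simp add: rep_summand[OF i y])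
    show "norm ((1/c) *\<^sub>R S y) = norm y" using c(1) c(2)[OF y] by simp
    show "(1/c) *\<^sub>R S (y + z) = (1/c) *\<^sub>R S y + (1/c) *\<^sub>R S z" for z
      by (simp add: blinfun.add_right scaleR_add_right)
    show "(1/c) *\<^sub>R S (b *\<^sub>C y) = b *\<^sub>C (1/c) *\<^sub>R S y" for b
      by (simp add: bounded_opsD[OF commutant_bounded[OF S]] scaleR_scaleC scaleC_scaleC mult.commute)
  qed
  then show False using atomic i j \<open>i \<noteq> j\<close> by (simp add: atomic_decomposition_def)
qed

text \<open>An element \<open>T\<close> of the commutant has no components between different summands, so it preserves
  each summand and commutes with the projection on the dense span of all of them.\<close>

lemma summand_proj_generated_vn:
  assumes i: "i \<in> I"
  shows "summand_proj i \<in> generated_vn \<pi>"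
  unfolding generated_vn_def
proof (rule commutantI)
  show "summand_proj i \<in> bounded_ops" using projD(1)[OF summand_proj_projection[OF i]] .
  fix T x assume T: "T \<in> commutant (range \<pi>)"
  have inv: "T y \<in> K k" if k: "k \<in> I" and y: "y \<in> K k" for k y
  proof -
    let ?z = "T y - summand_proj k (T y)"
    have Pz: "summand_proj l ?z = 0" if l: "l \<in> I" for l
    proof (cases "l = k")
      case True
      then show ?thesis by (simp add: blinfun.diff_right projD(2)[OF summand_proj_projection[OF k]])
    next
      case False
      then show ?thesis using no_intertwiner[OF k l _ T y] summand_proj_orthogonal[OF l k] proj_onD(2)[OF proj_on_summand[OF k]]
        by (simp add: blinfun.diff_right)
    qed
    have "?z \<in> {u. cinner u ?z = 0}"
    proof (rule dense_cspan_subspace[OF summands_dense])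
      show "(\<Union>i\<in>I. K i) \<subseteq> {u. cinner u ?z = 0}"
      proof
        fix u assume "u \<in> (\<Union>i\<in>I. K i)"
        then obtain l where "l \<in> I" "u \<in> K l" by blast
        then have "cinner ?z u = 0" using Pz summand_proj_eq_zero by blast
        then show "u \<in> {u. cinner u ?z = 0}" using cinner_commute[of u ?z] by simp
      qed
    qed (rule csubspace_Collect_cinner closed_Collect_cinner)+
    then have "T y = summand_proj k (T y)" by simp
    then show ?thesis using proj_onD(2)[OF proj_on_summand[OF k]] by metis
  qed
  have "x \<in> {x. summand_proj i (T x) = T (summand_proj i x)}"
  proof (rule dense_cspan_subspace[OF summands_dense])
    show "(\<Union>i\<in>I. K i) \<subseteq> {x. summand_proj i (T x) = T (summand_proj i x)}"
    proof
      fix u assume "u \<in> (\<Union>i\<in>I. K i)"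
      then obtain k where k: "k \<in> I" "u \<in> K k" by blast
      show "u \<in> {x. summand_proj i (T x) = T (summand_proj i x)}"
      proof (cases "k = i")
        case True
        then show ?thesis using inv[OF k] k proj_onD(3)[OF proj_on_summand[OF i]] by simp
      next
        case False
        then show ?thesis using inv[OF k] k summand_proj_orthogonal[OF i k(1)] by (simp add: blinfun.zero_right)
      qed
    qed
    show "csubspace {x. summand_proj i (T x) = T (summand_proj i x)}"
      using bounded_opsD[OF projD(1)[OF summand_proj_projection[OF i]]] bounded_opsD[OF commutant_bounded[OF T]]
      by (auto simp: complex_vector.subspace_def blinfun.bilinear_simps)
    show "closed {x. summand_proj i (T x) = T (summand_proj i x)}" by (intro closed_Collect_eq continuous_intros)
  qed
  then show "summand_proj i (T x) = T (summand_proj i x)" by simp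
qed

text \<open>The projection onto the summand is central in the von Neumann algebra, so its product with \<open>p\<close> is
  a subprojection of \<open>p\<close>, and minimality applies.\<close>

lemma minimal_projection_summand:
  assumes p: "p \<in> minimal_projections (generated_vn \<pi>)" and i: "i \<in> I"
  shows "(\<forall>x\<in>K i. p x = 0) \<or> range (blinfun_apply p) \<subseteq> K i"
proof -
  have pP: "p \<in> projections_in (generated_vn \<pi>)" using p by (simp add: minimal_projections_def)
  note pD = projD[OF pP] and PD = projD[OF summand_proj_projection[OF i]]
  have comm: "p (summand_proj i x) = summand_proj i (p x)" for x
    using pD(4) summand_proj_commutant[OF i] unfolding generated_vn_def by (rule commutantD)
  define q where "q = summand_proj i o\<^sub>L p"
  have qM: "q \<in> generated_vn \<pi>"
    using pD(4) summand_proj_generated_vn[OF i] by (simp add: q_def generated_vn_def commutant_compose)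
  have q: "q \<in> projections_in (generated_vn \<pi>)"
    unfolding projections_in_def
  proof (intro CollectI conjI qM)
    show "q \<in> bounded_ops" using pD(1) PD(1) by (simp add: q_def bounded_ops_compose)
    show "q o\<^sub>L q = q" by (rule blinfun_eqI) (simp add: q_def comm pD(2) PD(2))
    show "is_adjoint q q" by (simp add: is_adjoint_def q_def PD(3) pD(3) comm)
  qed
  have "range (blinfun_apply q) \<subseteq> range (blinfun_apply p)"
    by (auto simp: q_def simp flip: comm)
  then have "op_le q p" using op_le_projections_iff[OF q pP] by simp
  then have "q = 0 \<or> q = p" using p q by (simp add: minimal_projections_def)
  then show ?thesis
  proof
    assume "q = 0"
    then have "p x = 0" if "x \<in> K i" for x
      using proj_onD(3)[OF proj_on_summand[OF i] that] comm[of x]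
      by (metis blinfun.zero_left blinfun_apply_blinfun_compose q_def)
    then show ?thesis by blast
  next
    assume "q = p"
    then have "p x = summand_proj i (p x)" for x by (metis blinfun_apply_blinfun_compose q_def)
    then have "p x \<in> K i" for x using proj_onD(2)[OF proj_on_summand[OF i]] by metis
    then show ?thesis by blast
  qed
qed

lemma minimal_projection_kills:
  assumes p: "p \<in> minimal_projections (generated_vn \<pi>)" and ij: "i \<in> I" "j \<in> I" "i \<noteq> j"
    and v: "v \<in> K i" and w: "w \<in> K j"
  shows "p v = 0 \<or> p w = 0"
proof (rule ccontr)
  assume *: "\<not> (p v = 0 \<or> p w = 0)"
  then have "p v \<in> K i" "p v \<in> K j"
    using minimal_projection_summand[OF p] ij v w by blast+
  then have "cinner (p v) (p v) = 0" using summands_orthogonal ij by blast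
  then show False using * by simp
qed

end

section \<open>The diagonal projection\<close>

lemma projections_in_UNIV: "p \<in> projections_in M \<Longrightarrow> p \<in> projections_in UNIV"
  by (simp add: projections_in_def)

text \<open>The supremum is the projection onto the closed span \<open>V\<close> of all ranges. It belongs to the
  bicommutant because \<open>T\<close> in the commutant and its adjoint both preserve the orthogonal complement of
  \<open>V\<close>, the common kernel of \<open>\<E>\<close>. Taking \<open>V\<close> as a double orthogonal complement makes closedness and
  linearity immediate.\<close>

lemma ex_sup_projection:
  fixes \<E> :: "('h::complex_hilbert_space \<Rightarrow>\<^sub>L 'h) set"
  assumes E: "\<E> \<subseteq> projections_in UNIV" and N: "\<E> \<subseteq> N"
  obtains P where "P \<in> projections_in (commutant (commutant N))"
    "\<And>x. P x = 0 \<longleftrightarrow> (\<forall>e\<in>\<E>. e x = 0)"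
    "\<forall>e\<in>\<E>. op_le e P"
    "\<forall>Q\<in>projections_in UNIV. (\<forall>e\<in>\<E>. op_le e Q) \<longrightarrow> op_le P Q"
proof -
  define R where "R = (\<Union>e\<in>\<E>. range (blinfun_apply e))"
  define V where "V = orth_compl (orth_compl R)"
  have RV: "R \<subseteq> V" unfolding V_def orth_compl_def by clarify (metis cinner_commute complex_cnj_zero)
  have R_iff: "x \<in> orth_compl R \<longleftrightarrow> (\<forall>e\<in>\<E>. e x = 0)" for x
  proof
    assume x: "x \<in> orth_compl R"
    show "\<forall>e\<in>\<E>. e x = 0"
    proof
      fix e assume e: "e \<in> \<E>"
      then have "e (e x) \<in> R" by (auto simp: R_def)
      then have "cinner x (e (e x)) = 0" using x by (simp add: orth_compl_def)
      moreover have "e \<in> projections_in UNIV" using e E by blast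
      ultimately show "e x = 0" using projD(3)[of e UNIV x "e x"] by simp
    qed
  next
    assume *: "\<forall>e\<in>\<E>. e x = 0"
    show "x \<in> orth_compl R"
      unfolding orth_compl_def R_def
    proof clarify
      fix e z assume "e \<in> \<E>"
      then show "cinner x (e z) = 0" using * E projD(3)[of e UNIV x z] by (auto simp: cinner.zero_left)
    qed
  qed
  have "V = (\<Inter>y\<in>orth_compl R. {x. cinner x y = 0})" by (auto simp: V_def orth_compl_def)
  then have "closed V" using closed_Collect_cinner by auto
  then obtain P where P: "proj_on V P" using ex_proj_on csubspace_orth_compl V_def by metis
  note PU = proj_onD(1)[OF P]
  have P0: "P x = 0 \<longleftrightarrow> (\<forall>e\<in>\<E>. e x = 0)" for x
  proof
    assume "P x = 0"
    have "x \<in> orth_compl R"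
      unfolding orth_compl_def
    proof clarify
      fix y assume "y \<in> R"
      then have "P y = y" using RV proj_onD(3)[OF P] by blast
      then have "cinner x y = cinner (P x) y" using projD(3)[OF PU] by metis
      then show "cinner x y = 0" using \<open>P x = 0\<close> by (simp add: cinner.zero_left)
    qed
    then show "\<forall>e\<in>\<E>. e x = 0" using R_iff by blast
  next
    assume "\<forall>e\<in>\<E>. e x = 0"
    then have "x \<in> orth_compl R" using R_iff by blast
    then have "cinner (P (P x)) x = 0" using proj_onD(2)[OF P] by (simp add: V_def orth_compl_def)
    then show "P x = 0" using projD(2)[OF PU] projD(3)[OF PU] by (metis cinner_eq_zero_iff)
  qed
  have "P \<in> commutant (commutant N)"
  proof (rule commutantI)
    show "P \<in> bounded_ops" using projD(1)[OF PU] .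
    fix T x assume T: "T \<in> commutant N"
    obtain T' where T': "is_adjoint T T'" using ex_adjoint[OF commutant_bounded[OF T]] by blast
    have Te: "T (e y) = e (T y)" if "e \<in> \<E>" for e y using commutantD[OF T] that N by blast
    have T'e: "T' (e y) = e (T' y)" if e: "e \<in> \<E>" for e y
    proof (rule cinner_eqI)
      fix z
      have "e \<in> projections_in UNIV" using e E by blast
      note eD = projD(3)[OF this]
      show "cinner (T' (e y)) z = cinner (e (T' y)) z"
        by (simp add: is_adjointD[OF is_adjoint_sym[OF T']] eD Te[OF e])
    qed
    have P0T: "P (T y) = 0" "P (T' y) = 0" if "P y = 0" for y
      using that Te T'e by (auto simp: P0 blinfun.zero_right simp flip: Te T'e)
    have "T o\<^sub>L P = P o\<^sub>L T"
    proof (rule proj_commute[OF PU])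
      show "P (T y) = 0" if "P y = 0" for y using P0T that by blast
      show "P (T (P y)) = T (P y)" for y
      proof (rule cinner_eqI)
        fix z
        have "P (T' (z - P z)) = 0" by (rule P0T) (simp add: blinfun.diff_right projD(2)[OF PU])
        then have "cinner (T (P y)) (z - P z) = 0"
          by (simp add: is_adjointD[OF T'] projD(3)[OF PU] cinner.zero_right)
        then show "cinner (P (T (P y))) z = cinner (T (P y)) z"
          by (simp add: projD(3)[OF PU] cinner.diff_right)
      qed
    qed
    then show "P (T x) = T (P x)" by (metis blinfun_apply_blinfun_compose)
  qed
  then have PN: "P \<in> projections_in (commutant (commutant N))"
    using PU by (simp add: projections_in_def)
  show ?thesis
  proof (rule that[OF PN P0])
    show "\<forall>e\<in>\<E>. op_le e P"
    proof
      fix e assume e: "e \<in> \<E>"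
      have "e \<in> projections_in UNIV" using e E by blast
      moreover have "range (blinfun_apply e) \<subseteq> range (blinfun_apply P)"
        using RV e by (auto simp: proj_onD(4)[OF P] R_def)
      ultimately show "op_le e P" using op_le_projections_iff[OF _ PU] by blast
    qed
    show "\<forall>Q\<in>projections_in UNIV. (\<forall>e\<in>\<E>. op_le e Q) \<longrightarrow> op_le P Q"
    proof (intro ballI impI)
      fix Q assume Q: "Q \<in> projections_in UNIV" and le: "\<forall>e\<in>\<E>. op_le e Q"
      have "x \<in> range (blinfun_apply Q)" if x: "x \<in> V" for x
      proof -
        have "e (x - Q x) = 0" if e: "e \<in> \<E>" for e
        proof -
          have eU: "e \<in> projections_in UNIV" using e E by blast
          have "range (blinfun_apply e) \<subseteq> range (blinfun_apply Q)"
            using op_le_projections_iff[OF eU Q] le e by simp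
          then have Qe: "Q (e y) = e y" for y using proj_fixes_range[OF Q] by blast
          show ?thesis
            by (rule cinner_eqI)
              (simp add: projD(3)[OF eU] cinner.diff_left projD(3)[OF Q] Qe cinner.zero_left)
        qed
        then have "x - Q x \<in> orth_compl R" using R_iff by blast
        then have "cinner x (x - Q x) = 0" using x by (simp add: V_def orth_compl_def)
        then have "(norm (x - Q x))\<^sup>2 = 0"
          using projD(3)[OF Q, of x "x - Q x"]
          by (simp add: norm_sq_cinner cinner.diff_left blinfun.diff_right projD(2)[OF Q] cinner.zero_right)
        then show ?thesis by (metis eq_iff_diff_eq_0 norm_eq_zero power_eq_0_iff rangeI)
      qed
      then show "op_le P Q" using op_le_projections_iff[OF PU Q] proj_onD(4)[OF P] by blast
    qed
  qed
qed

lemma (in tensor_product) op_tensor_projection: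
  assumes p: "p \<in> projections_in M" and q: "q \<in> projections_in N"
  shows "op_tensor t p q \<in> projections_in UNIV"
proof -
  note pD = projD[OF p] and qD = projD[OF q]
  let ?E = "op_tensor t p q"
  have E: "?E \<in> bounded_ops" "\<And>v w. ?E (t v w) = t (p v) (q w)"
    using op_tensor_bounded op_tensor_apply pD(1) qD(1) by blast+
  have "?E o\<^sub>L ?E = ?E"
    using E bounded_ops_compose[OF E(1) E(1)] pD(2) qD(2)
    by (intro tensor_eqI) (auto simp: bounded_ops_def)
  moreover have "is_adjoint ?E ?E"
  proof -
    obtain E' where E': "E' \<in> bounded_ops" "is_adjoint ?E E'" using ex_adjoint[OF E(1)] by blast
    have "E' (t v w) = ?E (t v w)" for v w
    proof -
      let ?d = "E' (t v w) - ?E (t v w)"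
      have "?d \<in> {u. cinner u ?d = 0}"
      proof (rule dense_cspan_subspace[OF dense_tensor])
        show "range (\<lambda>(v, w). t v w) \<subseteq> {u. cinner u ?d = 0}"
          by (auto simp: cinner.diff_right E(2) cinner_tensor pD(3) qD(3)
              simp flip: is_adjointD[OF E'(2)])
      qed (rule csubspace_Collect_cinner closed_Collect_cinner)+
      then show ?thesis by simp
    qed
    then have "E' = ?E" using E E' by (intro tensor_eqI) (auto simp: bounded_ops_def)
    then show ?thesis using E'(2) by simp
  qed
  ultimately show ?thesis using E(1) by (simp add: projections_in_def)
qed

text \<open>The diagonal projection is given by a definite description, so the supremum has to be shown to
  exist and to be unique before anything can be said about it.\<close>

lemma diag_proj_properties:
  fixes t :: "'h::complex_hilbert_space \<Rightarrow> 'h \<Rightarrow> 't::complex_hilbert_space"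
  assumes t: "hilbert_tensor t"
  shows "diag_proj t \<pi> \<in> projections_in UNIV"
    and "diag_proj t \<pi> x = 0 \<longleftrightarrow>
      (\<forall>p\<in>minimal_projections (generated_vn \<pi>). op_tensor t p p x = 0)"
proof -
  interpret tensor_product t using t by unfold_locales
  let ?M = "generated_vn \<pi>"
  let ?mp = "minimal_projections ?M"
  let ?N = "{op_tensor t S T | S T. S \<in> ?M \<and> T \<in> ?M}"
  have A: "(\<lambda>p. op_tensor t p p) ` ?mp \<subseteq> projections_in UNIV"
    using op_tensor_projection by (auto simp: minimal_projections_def)
  have B: "(\<lambda>p. op_tensor t p p) ` ?mp \<subseteq> ?N"
    by (auto simp: minimal_projections_def projections_in_def)
  obtain P where P: "P \<in> projections_in (vn_tensor t ?M ?M)"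
    and P0: "\<And>x. P x = 0 \<longleftrightarrow> (\<forall>e\<in>(\<lambda>p. op_tensor t p p) ` ?mp. e x = 0)"
    and ub: "\<forall>e\<in>(\<lambda>p. op_tensor t p p) ` ?mp. op_le e P"
    and lub: "\<forall>Q\<in>projections_in UNIV. (\<forall>e\<in>(\<lambda>p. op_tensor t p p) ` ?mp. op_le e Q) \<longrightarrow> op_le P Q"
    by (rule ex_sup_projection[OF A B, folded vn_tensor_def]) (rule that)
  have "diag_proj t \<pi> = P"
    unfolding diag_proj_def Let_def
  proof (rule the_equality)
    show *: "P \<in> projections_in (vn_tensor t ?M ?M) \<and> (\<forall>p\<in>?mp. op_le (op_tensor t p p) P) \<and>
      (\<forall>Q\<in>projections_in (vn_tensor t ?M ?M). (\<forall>p\<in>?mp. op_le (op_tensor t p p) Q) \<longrightarrow> op_le P Q)"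
      using P ub lub projections_in_UNIV by blast
    fix P' assume P': "P' \<in> projections_in (vn_tensor t ?M ?M) \<and> (\<forall>p\<in>?mp. op_le (op_tensor t p p) P') \<and>
      (\<forall>Q\<in>projections_in (vn_tensor t ?M ?M). (\<forall>p\<in>?mp. op_le (op_tensor t p p) Q) \<longrightarrow> op_le P' Q)"
    have "op_le P P'" "op_le P' P" using * P' by blast+
    then have "range (blinfun_apply P') = range (blinfun_apply P)"
      using op_le_projections_iff[OF P conjunct1[OF P']] op_le_projections_iff[OF conjunct1[OF P'] P]
      by (simp add: subset_antisym)
    then show "P' = P" by (rule proj_eqI[OF conjunct1[OF P'] P])
  qed
  then show "diag_proj t \<pi> \<in> projections_in UNIV"
    and "diag_proj t \<pi> x = 0 \<longleftrightarrow> (\<forall>p\<in>?mp. op_tensor t p p x = 0)"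
    using P P0 projections_in_UNIV by auto
qed

lemma (in atomic_rep) tensor_off_diag:
  assumes t: "hilbert_tensor t" and ij: "i \<in> I" "j \<in> I" "i \<noteq> j" and v: "v \<in> K i" and w: "w \<in> K j"
  shows "t v w \<in> off_diag t \<pi>"
proof -
  interpret tensor_product t using t by unfold_locales
  have "op_tensor t p p (t v w) = 0" if p: "p \<in> minimal_projections (generated_vn \<pi>)" for p
  proof -
    have "p \<in> bounded_ops" using p by (simp add: minimal_projections_def projections_in_def)
    then have "op_tensor t p p (t v w) = t (p v) (p w)" using op_tensor_apply by blast
    then have "norm (op_tensor t p p (t v w)) = 0"
      using minimal_projection_kills[OF p ij v w] by (auto simp: norm_tensor)
    then show ?thesis by simp
  qed
  then have "diag_proj t \<pi> (t v w) = 0" using diag_proj_properties(2)[OF t] by blast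
  then show ?thesis
    using projD(3)[OF diag_proj_properties(1)[OF t], of \<pi> "t v w"]
    by (auto simp: off_diag_def orth_compl_def cinner.zero_left)
qed

section \<open>The distance between inequivalent pure states\<close>

text \<open>The inverse of \<open>\<rho>\<close> is evaluated at \<open>\<rho> \<xi>\<close> divided by its norm, which lies in the unit ball over
  which the seminorm is a supremum.\<close>

lemma lip_seminorm_bound:
  fixes \<rho> :: "'t::complex_hilbert_space \<Rightarrow>\<^sub>L 't"
  assumes inj: "\<not> (\<exists>\<xi>\<in>off_diag t \<pi>. \<xi> \<noteq> 0 \<and> \<rho> \<xi> = 0)"
    and lip: "lip_seminorm t \<rho> \<pi> a \<le> 1" and \<xi>: "\<xi> \<in> off_diag t \<pi>"
  shows "norm ((op_tensor t (\<pi> a) id_blinfun - op_tensor t id_blinfun (\<pi> a)) \<xi>) \<le> norm (\<rho> \<xi>)"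
proof (cases "\<rho> \<xi> = 0")
  case True
  then have "\<xi> = 0" using inj \<xi> by blast
  then show ?thesis by (simp add: blinfun.zero_right)
next
  case False
  let ?D = "op_tensor t (\<pi> a) id_blinfun - op_tensor t id_blinfun (\<pi> a)"
  let ?V = "off_diag t \<pi>"
  define n where "n = norm (\<rho> \<xi>)"
  define \<zeta> where "\<zeta> = (1/n) *\<^sub>R \<xi>"
  have n: "n > 0" using False by (simp add: n_def)
  have V: "csubspace ?V" unfolding off_diag_def by (rule csubspace_orth_compl)
  have \<zeta>: "\<zeta> \<in> ?V" unfolding \<zeta>_def using V \<xi> by (rule csubspace_scaleR)
  have "inj_on (blinfun_apply \<rho>) ?V"
  proof (rule inj_onI)
    fix x y assume "x \<in> ?V" "y \<in> ?V" "\<rho> x = \<rho> y"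
    then have "x - y \<in> ?V" "\<rho> (x - y) = 0"
      using complex_vector.subspace_diff[OF V] by (auto simp: blinfun.diff_right)
    then show "x = y" using inj by (metis eq_iff_diff_eq_0)
  qed
  then have inv: "inv_into ?V (blinfun_apply \<rho>) (\<rho> \<zeta>) = \<zeta>" using \<zeta> by (rule inv_into_f_f)
  have "\<rho> \<zeta> \<in> {\<eta> \<in> blinfun_apply \<rho> ` ?V. norm \<eta> \<le> 1}"
  proof (intro CollectI conjI imageI \<zeta>)
    show "norm (\<rho> \<zeta>) \<le> 1" using n by (simp add: \<zeta>_def blinfun.scaleR_right n_def)
  qed
  then have "ennreal (norm (?D (inv_into ?V (blinfun_apply \<rho>) (\<rho> \<zeta>)))) \<le> lip_seminorm t \<rho> \<pi> a"
    unfolding lip_seminorm_def by (rule SUP_upper)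
  then have "ennreal (norm (?D \<zeta>)) \<le> 1" using lip unfolding inv by (rule order_trans)
  then have "norm (?D \<zeta>) \<le> 1" by simp
  then have "norm (?D \<xi>) / n \<le> 1" using n by (simp add: \<zeta>_def blinfun.scaleR_right)
  then show ?thesis using n by (simp add: n_def)
qed

theorem mainTheorem6:
  fixes t :: "'h::complex_hilbert_space \<Rightarrow> 'h \<Rightarrow> 't::complex_hilbert_space"
    and t3 :: "'t \<Rightarrow> 'h \<Rightarrow> 's::complex_hilbert_space"
    and \<pi> :: "'a::unital_cstar_algebra \<Rightarrow> 'h \<Rightarrow>\<^sub>L 'h"
    and \<rho> :: "'t \<Rightarrow>\<^sub>L 't"
    and I :: "'i set"
    and H :: "'i \<Rightarrow> 'h set"
    and \<pi>' :: "'i \<Rightarrow> 'a \<Rightarrow> 'h \<Rightarrow> 'h"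
    and \<phi> \<psi> :: "'a \<Rightarrow> complex"
  assumes "hilbert_tensor t" and "hilbert_tensor t3"
    and "compact_quantum_metric_space t t3 \<rho> \<pi>"
    and "atomic_decomposition I H \<pi>' \<pi>"
    and "i \<in> I" and "j \<in> I" and "i \<noteq> j"
    and "v \<in> H i" and "norm v = 1"
    and "w \<in> H j" and "norm w = 1"
    and "\<phi> = (\<lambda>a. cinner (\<pi>' i a v) v)"
    and "\<psi> = (\<lambda>a. cinner (\<pi>' j a w) w)"
  shows "monge_kantorovich t \<rho> \<pi> \<phi> \<psi> \<le> ennreal (norm (\<rho> (t v w)))"
proof -
  interpret tensor_product t using assms(1) by unfold_locales
  have rep: "representation_on UNIV (\<lambda>a. blinfun_apply (\<pi> a))"
    and inj: "\<not> (\<exists>\<xi>\<in>off_diag t \<pi>. \<xi> \<noteq> 0 \<and> \<rho> \<xi> = 0)"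
    using assms(3) by (simp_all add: compact_quantum_metric_space_def faithful_atomic_def)
  interpret atomic_rep I H \<pi>' \<pi> using assms(4) rep by unfold_locales
  have off: "t v w \<in> off_diag t \<pi>" by (rule tensor_off_diag) fact+
  have id: "id_blinfun \<in> (bounded_ops :: ('h \<Rightarrow>\<^sub>L 'h) set)" by (simp add: bounded_ops_def clinear_op_def)
  show ?thesis
    unfolding monge_kantorovich_def
  proof (rule SUP_least, rule ennreal_leI)
    fix a assume "a \<in> {a. star a = a \<and> lip_seminorm t \<rho> \<pi> a \<le> 1}"
    then have lip: "lip_seminorm t \<rho> \<pi> a \<le> 1" by simp
    let ?D = "op_tensor t (\<pi> a) id_blinfun - op_tensor t id_blinfun (\<pi> a)"
    have "?D (t v w) = t (\<pi> a v) w - t v (\<pi> a w)"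
      by (simp add: blinfun.diff_left op_tensor_apply rep_bounded id)
    then have "cinner (?D (t v w)) (t v w) = \<phi> a - \<psi> a"
      using assms by (simp add: cinner.diff_left cinner_tensor cinner_self rep_summand)
    then have "cmod (\<phi> a - \<psi> a) \<le> norm (?D (t v w)) * norm (t v w)"
      by (metis cinner_Cauchy_Schwarz)
    also have "\<dots> = norm (?D (t v w))" using assms by (simp add: norm_tensor)
    also have "\<dots> \<le> norm (\<rho> (t v w))" by (rule lip_seminorm_bound[OF inj lip off])
    finally show "cmod (\<phi> a - \<psi> a) \<le> norm (\<rho> (t v w))" .
  qed
qed

end
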